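(* Fix $0<\alpha<\frac12$ and $1-\alpha<\beta<1$. Let $0<\gamma<\min\big(\frac12,\frac{\alpha+\beta-1}{\beta}\big)$ and fix some $I\subset\{1,\dots,n\}$ satisfying $\sum_{i\in I}\pi(\Omega_i)>\beta$. Define $$\mathcal T=\min\Big\{T\in\mathbb N:\ \min_{0<t<T}\ \max_{i\in I}\Big(\frac{\varphi_i}{c'_\gamma\,t}+\max_{z\in\Omega}\mathbb P_z[\kappa_i(T)<t]\Big)<\frac14\Big\}.$$ Then the mixing time $\tau_{\mathrm{mix}}$ of $\{X_t\}_{t\in\mathbb N}$ satisfies $$\tau_{\mathrm{mix}}\le\frac43\,c_\alpha\,\mathcal T.$$
   Context: $\mathbb N=\{0,1,2,\dots\}$. $\{X_t\}_{t\in\mathbb N}$ is an irreducible, reversible, $\frac12$-lazy (i.e. $K(x,x)\ge\frac12$ for all $x$) Markov chain with kernel $K$ and stationary distribution $\pi$ on a finite state space $\Omega$ with $|\Omega|\ge2$. $\mathbb P_z,\mathbb E_z$ refer to the chain started at $X_0=z$. The mixing time of a Markov chain is the smallest $t>0$ such that $\max_x\|\mathcal L(X_t\mid X_0=x)-\pi\|_{\mathrm{TV}}<\frac14$, where $\|\mu-\nu\|_{\mathrm{TV}}=\max_A(\mu(A)-\nu(A))$. $\Omega=\bigsqcup_{i=1}^n\Omega_i$ is a partition into $n$ nonempty parts. The trace of the chain on $\Omega_i$ is the Markov chain on $\Omega_i$ obtained by observing $X_t$ only at its successive visits to $\Omega_i$; its kernel is $K_i(x,y)=\mathbb P_x[X_{\sigma}=y]$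 with $\sigma=\min\{t\ge1:X_t\in\Omega_i\}$. $\varphi_i$ is the mixing time of $K_i$. The occupation time $\kappa_i(s)$ is the number of times $u\in\{0,1,\dots,s\}$ with $X_u\in\Omega_i$. Constants: for $0<\alpha<\frac12$, $c_\alpha,c'_\alpha>0$ denote universal constants (which exist by known results of Peres--Sousi and Oliveira) such that for every irreducible, $\frac12$-lazy, reversible Markov chain on a finite state space with at least two points, with stationary distribution $\pi$ and mixing time $\tau_{\mathrm{mix}}$, $$c'_\alpha\max_{z,\,A:\pi(A)\ge\alpha}\mathbb E_z[\tau_A]\le\tau_{\mathrm{mix}}\le c_\alpha\max_{z,\,A:\pi(A)\ge\alpha}\mathbb E_z[\tau_A],\qquad \tau_A=\min\{t\ge0:X_t\in A\}.$$ *)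

theory Defs
  imports "HOL-Probability.Probability"
begin

text \<open>
  A finite Markov chain is given by a finite carrier \<open>S\<close> and a transition matrix \<open>K\<close>, of which only
  the values on \<open>S \<times> S\<close> matter.
\<close>

definition stochastic_on :: "'a set \<Rightarrow> ('a \<Rightarrow> 'a \<Rightarrow> real) \<Rightarrow> bool" where
  "stochastic_on S K \<longleftrightarrow> (\<forall>x\<in>S. (\<forall>y\<in>S. 0 \<le> K x y) \<and> (\<Sum>y\<in>S. K x y) = 1)"

definition chain_step :: "'a set \<Rightarrow> ('a \<Rightarrow> 'a \<Rightarrow> real) \<Rightarrow> 'a \<Rightarrow> nat \<Rightarrow> (nat \<Rightarrow> 'a) \<Rightarrow> 'a measure" where
  "chain_step S K z i \<omega> =
     (if i = 0 then return (count_space S) z else point_measure S (\<lambda>y. ennreal (K (\<omega> (i - 1)) y)))"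

text \<open>
  The law \<open>\<P>\<^sub>z\<close> of the chain on the path space \<open>\<nat> \<Rightarrow> S\<close>, given by the Ionescu-Tulcea theorem;
  \<open>X\<^sub>t\<close> is the coordinate \<open>\<omega> t\<close>. It is meaningful under the assumptions of the lemma that follows.
\<close>

definition path_law :: "'a set \<Rightarrow> ('a \<Rightarrow> 'a \<Rightarrow> real) \<Rightarrow> 'a \<Rightarrow> (nat \<Rightarrow> 'a) measure" where
  "path_law S K z =
     projective_family.lim UNIV
       (Ionescu_Tulcea.CI (chain_step S K z) (\<lambda>_. count_space S)) (\<lambda>_. count_space S)"

lemma Ionescu_Tulcea_chain_step:
  assumes "finite S" "stochastic_on S K" "z \<in> S"
  shows "Ionescu_Tulcea (chain_step S K z) (\<lambda>_. count_space S)"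
proof (rule Ionescu_Tulcea.intro)
  have step: "point_measure S (\<lambda>y. ennreal (K x y)) \<in> space (subprob_algebra (count_space S))"
    "prob_space (point_measure S (\<lambda>y. ennreal (K x y)))" if "x \<in> S" for x
  proof -
    have "(\<Sum>y\<in>S. ennreal (K x y)) = 1"
      using assms(2) that by (subst sum_ennreal) (auto simp: stochastic_on_def)
    then show p: "prob_space (point_measure S (\<lambda>y. ennreal (K x y)))"
      using assms(1) by (intro prob_spaceI) (simp add: space_point_measure emeasure_point_measure_finite)
    show "point_measure S (\<lambda>y. ennreal (K x y)) \<in> space (subprob_algebra (count_space S))"
      using p by (simp add: space_subprob_algebra prob_space_imp_subprob_space sets_point_measure)
  qed
  have ret: "return (count_space S) z \<in> space (subprob_algebra (count_space S))"
    using assms(3) by (simp add: space_subprob_algebra prob_space_return prob_space_imp_subprob_space)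
  show "chain_step S K z i \<in> measurable (PiM {0..<i} (\<lambda>_. count_space S)) (subprob_algebra (count_space S))" for i
  proof (cases "i = 0")
    case True
    then show ?thesis using ret by (simp add: chain_step_def[abs_def])
  next
    case False
    have "(\<lambda>x. point_measure S (\<lambda>y. ennreal (K x y))) \<in> measurable (count_space S) (subprob_algebra (count_space S))"
      using step(1) by simp
    moreover have "(\<lambda>\<omega>. \<omega> (i - 1)) \<in> measurable (PiM {0..<i} (\<lambda>_. count_space S)) (count_space S)"
      using False by (intro measurable_component_singleton) auto
    ultimately have "(\<lambda>\<omega>. point_measure S (\<lambda>y. ennreal (K (\<omega> (i - 1)) y)))
        \<in> measurable (PiM {0..<i} (\<lambda>_. count_space S)) (subprob_algebra (count_space S))"
      by (rule measurable_compose[rotated])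
    then show ?thesis
      using False by (simp add: chain_step_def[abs_def])
  qed
  show "prob_space (chain_step S K z i \<omega>)" if "\<omega> \<in> space (PiM {0..<i} (\<lambda>_. count_space S))" for i \<omega>
  proof (cases "i = 0")
    case True
    then show ?thesis using assms(3) by (simp add: chain_step_def prob_space_return)
  next
    case False
    then have "\<omega> (i - 1) \<in> S" using that by (auto simp: space_PiM PiE_iff)
    then show ?thesis using False step(2) by (simp add: chain_step_def)
  qed
qed

text \<open>Vanishing outside \<open>S\<close> makes a stationary distribution unique as a function on the whole type.\<close>

definition is_stationary :: "'a set \<Rightarrow> ('a \<Rightarrow> 'a \<Rightarrow> real) \<Rightarrow> ('a \<Rightarrow> real) \<Rightarrow> bool" where
  "is_stationary S K \<pi> \<longleftrightarrow>
     (\<forall>x\<in>S. 0 \<le> \<pi> x) \<and> (\<forall>x. x \<notin> S \<longrightarrow> \<pi> x = 0) \<and> (\<Sum>x\<in>S. \<pi> x) = 1 \<and>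
     (\<forall>y\<in>S. (\<Sum>x\<in>S. \<pi> x * K x y) = \<pi> y)"

definition stationary_dist :: "'a set \<Rightarrow> ('a \<Rightarrow> 'a \<Rightarrow> real) \<Rightarrow> 'a \<Rightarrow> real" where
  "stationary_dist S K = (THE \<pi>. is_stationary S K \<pi>)"

definition irreducible_on :: "'a set \<Rightarrow> ('a \<Rightarrow> 'a \<Rightarrow> real) \<Rightarrow> bool" where
  "irreducible_on S K \<longleftrightarrow> (\<forall>x\<in>S. \<forall>y\<in>S. \<exists>t. 0 < \<P>(\<omega> in path_law S K x. \<omega> t = y))"

definition lazy_reversible_chain :: "'a set \<Rightarrow> ('a \<Rightarrow> 'a \<Rightarrow> real) \<Rightarrow> ('a \<Rightarrow> real) \<Rightarrow> bool" where
  "lazy_reversible_chain S K \<pi> \<longleftrightarrow>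
     finite S \<and> 2 \<le> card S \<and> stochastic_on S K \<and> irreducible_on S K \<and> is_stationary S K \<pi> \<and>
     (\<forall>x\<in>S. \<forall>y\<in>S. \<pi> x * K x y = \<pi> y * K y x) \<and>
     (\<forall>x\<in>S. 1/2 \<le> K x x)"

definition tv_dist :: "'a set \<Rightarrow> ('a set \<Rightarrow> real) \<Rightarrow> ('a set \<Rightarrow> real) \<Rightarrow> real" where
  "tv_dist S \<mu> \<nu> = (MAX A\<in>Pow S. \<mu> A - \<nu> A)"

definition mixing_time :: "'a set \<Rightarrow> ('a \<Rightarrow> 'a \<Rightarrow> real) \<Rightarrow> nat" where
  "mixing_time S K =
     (LEAST t. 0 < t \<and>
        (MAX x\<in>S. tv_dist S (\<lambda>A. \<P>(\<omega> in path_law S K x. \<omega> t \<in> A))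
                           (\<lambda>A. \<Sum>y\<in>A. stationary_dist S K y)) < 1/4)"

text \<open>The hitting time is infinite if the path never visits \<open>A\<close>.\<close>

definition hitting_time :: "'a set \<Rightarrow> (nat \<Rightarrow> 'a) \<Rightarrow> enat" where
  "hitting_time A \<omega> = (INF t\<in>{t. \<omega> t \<in> A}. enat t)"

definition max_expected_hitting ::
    "'a set \<Rightarrow> ('a \<Rightarrow> 'a \<Rightarrow> real) \<Rightarrow> ('a \<Rightarrow> real) \<Rightarrow> real \<Rightarrow> ennreal" where
  "max_expected_hitting S K \<pi> \<alpha> =
     (MAX (z, A)\<in>S \<times> {A. A \<subseteq> S \<and> \<alpha> \<le> (\<Sum>x\<in>A. \<pi> x)}.
        \<integral>\<^sup>+\<omega>. ennreal_of_enat (hitting_time A \<omega>) \<partial>path_law S K z)"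

text \<open>
  \<open>c \<alpha>\<close> and \<open>c' \<alpha>\<close> are valid constants for all finite chains. Every finite state space is in
  bijection with a finite set of natural numbers, so quantifying over carriers in \<open>nat\<close> covers all
  of them.
\<close>

definition mixing_hitting_constants :: "(real \<Rightarrow> real) \<Rightarrow> (real \<Rightarrow> real) \<Rightarrow> bool" where
  "mixing_hitting_constants c c' \<longleftrightarrow>
     (\<forall>\<alpha>. 0 < \<alpha> \<and> \<alpha> < 1/2 \<longrightarrow>
        0 < c \<alpha> \<and> 0 < c' \<alpha> \<and>
        (\<forall>(S :: nat set) K \<pi>. lazy_reversible_chain S K \<pi> \<longrightarrow>
           ennreal (c' \<alpha>) * max_expected_hitting S K \<pi> \<alpha> \<le> of_nat (mixing_time S K) \<and>
           of_nat (mixing_time S K) \<le> ennreal (c \<alpha>) * max_expected_hitting S K \<pi> \<alpha>))"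

definition trace_kernel :: "'a set \<Rightarrow> ('a \<Rightarrow> 'a \<Rightarrow> real) \<Rightarrow> 'a set \<Rightarrow> 'a \<Rightarrow> 'a \<Rightarrow> real" where
  "trace_kernel S K B x y =
     \<P>(\<omega> in path_law S K x. (\<exists>t\<ge>1. \<omega> t \<in> B) \<and> \<omega> (LEAST t. 1 \<le> t \<and> \<omega> t \<in> B) = y)"

definition occupation_time :: "'a set \<Rightarrow> nat \<Rightarrow> (nat \<Rightarrow> 'a) \<Rightarrow> nat" where
  "occupation_time B s \<omega> = card {u. u \<le> s \<and> \<omega> u \<in> B}"

text \<open>
  The time \<open>\<T>\<close>, with \<open>d\<close> standing for \<open>c'\<^sub>\<gamma>\<close>. The variable \<open>t\<close> ranges over integer times; the guard
  \<open>1 < T\<close> says that the range \<open>0 < t < T\<close> is nonempty, the minimum over the empty range being infinite.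
\<close>

definition partition_time ::
    "real \<Rightarrow> 'a set \<Rightarrow> ('a \<Rightarrow> 'a \<Rightarrow> real) \<Rightarrow> (nat \<Rightarrow> 'a set) \<Rightarrow> nat set \<Rightarrow> nat" where
  "partition_time d S K \<Omega> I =
     (LEAST T. 1 < T \<and>
        (MIN t\<in>{0<..<T}. MAX i\<in>I.
           real (mixing_time (\<Omega> i) (trace_kernel S K (\<Omega> i))) / (d * real t)
           + (MAX z\<in>S. \<P>(\<omega> in path_law S K z. occupation_time (\<Omega> i) T \<omega> < t))) < 1/4)"

end

(*
  If pi(A) >= alpha, then some part Omega_i with i in I satisfies pi(A cap Omega_i) >= gamma pi(Omega_i).
  The trace on Omega_i is again lazy and reversible, so by the lower bound in the hitting time
  characterization and Markov's inequality it misses A for its first t steps with probability at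
  most phi_i / (c'_gamma t). Hence the whole chain, from any state, misses A up to time T with
  probability at most phi_i / (c'_gamma t) + P[kappa_i(T) < t] < 1/4. Restarting every T steps
  gives E[tau_A] <= T (1 + 1/4 + 1/16 + ...) = 4 T / 3, and the upper bound of the characterization
  finishes the proof.
*)

theory Submission
  imports Defs
begin

subsection \<open>First-step analysis\<close>

text \<open>The trace chain is never realised as a process on the path space. Path probabilities are
  handled by conditioning on the first step and inducting on the horizon, so no stopping times and
  no strong Markov property are needed. The link to the trace on B is the entrance law
  \<open>hit_prob B z\<close>: it is harmonic off B and a point mass on B, and one step of
  \<open>K\<close> followed by it is the trace kernel. The trace miss probabilities averaged under
  this law bound the event that B is visited t times while A is missed.

  Three obstacles shape the rest. The time T is the least element of a set that must first be shown
  nonempty, which needs recurrence; recurrence, the total mass of the entrance law and uniqueness of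
  the stationary law all follow from one minimum principle. The constants are granted only for
  carriers of naturals with at least two points, hence the relabelling and the separate treatment of
  one-point parts. Finally, the times up to T are T + 1 instants, yet restarting costs only T,
  because consecutive blocks share an instant.\<close>

locale finite_chain =
  fixes S :: "'a set" and K :: "'a \<Rightarrow> 'a \<Rightarrow> real"
  assumes finite_S: "finite S" and stochastic: "stochastic_on S K"
begin

abbreviation path_space :: "(nat \<Rightarrow> 'a) measure" where
  "path_space \<equiv> PiM UNIV (\<lambda>_. count_space S)"

lemma K_nonneg: "x \<in> S \<Longrightarrow> y \<in> S \<Longrightarrow> 0 \<le> K x y"
  using stochastic by (simp add: stochastic_on_def)

lemma K_sum: "x \<in> S \<Longrightarrow> (\<Sum>y\<in>S. K x y) = 1"
  using stochastic by (simp add: stochastic_on_def)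

lemma space_path_space: "space path_space = {\<omega>. \<forall>t. \<omega> t \<in> S}"
  by (auto simp: space_PiM)

lemma
  assumes "z \<in> S"
  shows sets_path_law: "sets (path_law S K z) = sets path_space"
    and space_path_law: "space (path_law S K z) = {\<omega>. \<forall>t. \<omega> t \<in> S}"
    and prob_space_path_law: "prob_space (path_law S K z)"
proof -
  interpret IT: Ionescu_Tulcea "chain_step S K z" "\<lambda>_. count_space S"
    using Ionescu_Tulcea_chain_step[OF finite_S stochastic assms] .
  show *: "sets (path_law S K z) = sets path_space"
    by (simp add: path_law_def)
  then show "space (path_law S K z) = {\<omega>. \<forall>t. \<omega> t \<in> S}"
    using sets_eq_imp_space_eq[OF *] by (simp add: space_path_space)
  \<comment> \<open>The cylinder over the empty index set is the whole space, so the
    finite-dimensional law over \<open>{}\<close> yields the total mass.\<close>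
  have "emeasure IT.PF.lim (IT.PF.emb UNIV {} (space (PiM {} (\<lambda>_. count_space S)))) = 1"
    using IT.PF.prob_space_P[of "{}"]
    by (subst IT.lim) (auto simp: IT.CI_def prob_space.emeasure_space_1
          dest: prob_space.emeasure_space_1)
  moreover have "IT.PF.emb UNIV {} (space (PiM {} (\<lambda>_. count_space S))) = space IT.PF.lim"
    by (auto simp: prod_emb_def space_PiM)
  ultimately show "prob_space (path_law S K z)"
    by (intro prob_spaceI) (simp add: path_law_def)
qed

text \<open>The expectation of \<open>g\<close> at time n on the event that the path stays in the
  box before time n, under the law of the coordinates 0 to n. Leaving the terminal function
  \<open>g\<close> free lets it absorb the last transition, which is what the inductions below run
  on.\<close>

definition box_integral :: "(nat \<Rightarrow> 'a set) \<Rightarrow> nat \<Rightarrow> ('a \<Rightarrow> ennreal) \<Rightarrow> 'a \<Rightarrow> ennreal" where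
  "box_integral F n g z =
     (\<integral>\<^sup>+\<omega>. (if \<forall>i<n. \<omega> i \<in> F i then g (\<omega> n) else 0)
        \<partial>Ionescu_Tulcea.C (chain_step S K z) (\<lambda>_. count_space S) 0 (Suc n) (\<lambda>_. undefined))"

lemma nn_integral_step:
  "x \<in> S \<Longrightarrow> (\<integral>\<^sup>+y. f y \<partial>point_measure S (\<lambda>y. ennreal (K x y))) = (\<Sum>y\<in>S. ennreal (K x y) * f y)"
  using finite_S by (subst nn_integral_point_measure_finite) (auto simp: K_nonneg)

lemma PiM_finite_steps: "PiM {0..<n::nat} (\<lambda>_. count_space S) = count_space ({0..<n} \<rightarrow>\<^sub>E S)"
  using finite_S by (intro count_space_PiM_finite) (auto intro: countable_finite)

lemma box_integral_0:
  assumes "z \<in> S"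
  shows "box_integral F 0 g z = g z"
proof -
  interpret IT: Ionescu_Tulcea "chain_step S K z" "\<lambda>_. count_space S"
    using Ionescu_Tulcea_chain_step[OF finite_S stochastic assms] .
  have u: "(\<lambda>_. undefined) \<in> space (PiM {0..<0::nat} (\<lambda>_. count_space S))"
    by (simp add: space_PiM)
  have m: "(\<lambda>\<omega>. g (\<omega> 0)) \<in> borel_measurable (PiM {0..<Suc 0} (\<lambda>_. count_space S))"
    unfolding PiM_finite_steps by simp
  have "box_integral F 0 g z = (\<integral>\<^sup>+\<omega>. g (\<omega> 0) \<partial>IT.eP 0 (\<lambda>_. undefined))"
    unfolding box_integral_def IT.C.simps add_0
    by (subst bind_return[OF IT.measurable_eP u]) simp
  also have "\<dots> = (\<integral>\<^sup>+x. g x \<partial>chain_step S K z 0 (\<lambda>_. undefined))"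
    by (subst IT.nn_integral_eP[OF u m]) simp
  also have "\<dots> = g z"
    using assms by (simp add: chain_step_def nn_integral_return)
  finally show ?thesis .
qed

text \<open>The construction of the law appends coordinates at the end of the path, and the appended
  kernel depends on coordinate n alone. Integrating out the last coordinate therefore leaves a new
  terminal function at time n, which also takes over the constraint \<open>F n\<close>.\<close>

lemma box_integral_Suc:
  assumes "z \<in> S"
  shows "box_integral F (Suc n) g z
    = box_integral F n (\<lambda>x. if x \<in> F n then \<Sum>y\<in>S. ennreal (K x y) * g y else 0) z"
proof -
  interpret IT: Ionescu_Tulcea "chain_step S K z" "\<lambda>_. count_space S"
    using Ionescu_Tulcea_chain_step[OF finite_S stochastic assms] .
  let ?f = "\<lambda>\<omega>. if \<forall>i<Suc n. \<omega> i \<in> F i then g (\<omega> (Suc n)) else 0"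
  let ?C = "IT.C 0 (Suc n) (\<lambda>_. undefined)"
  have u: "(\<lambda>_. undefined) \<in> space (PiM {0..<0::nat} (\<lambda>_. count_space S))"
    by (simp add: space_PiM)
  have m: "?f \<in> borel_measurable (PiM {0..<Suc (Suc n)} (\<lambda>_. count_space S))"
    unfolding PiM_finite_steps by simp
  have C: "measurable ?C = measurable (PiM {0..<Suc n} (\<lambda>_. count_space S))"
    by (intro ext measurable_cong_sets) (use IT.sets_C[OF u, of "Suc n"] in \<open>simp_all del: IT.C.simps\<close>)
  have if_conj: "(\<Sum>y\<in>S. k y * (if P \<and> Q then g y else 0)) = (if P then if Q then \<Sum>y\<in>S. k y * g y else 0 else 0)"
    for k P Q by (cases P; cases Q) simp_all
  have "box_integral F (Suc n) g z = (\<integral>\<^sup>+\<omega>. ?f \<omega> \<partial>Giry_Monad.bind ?C (IT.eP (Suc n)))"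
    unfolding box_integral_def IT.C.simps(2)[of 0 "Suc n"] by simp
  also have "\<dots> = (\<integral>\<^sup>+\<omega>. \<integral>\<^sup>+\<omega>'. ?f \<omega>' \<partial>IT.eP (Suc n) \<omega> \<partial>?C)"
    by (rule nn_integral_bind[OF m]) (simp add: C del: IT.C.simps)
  also have "\<dots> = (\<integral>\<^sup>+\<omega>. (if \<forall>i<n. \<omega> i \<in> F i then
      (if \<omega> n \<in> F n then \<Sum>y\<in>S. ennreal (K (\<omega> n) y) * g y else 0) else 0) \<partial>?C)"
  proof (rule nn_integral_cong)
    fix \<omega> assume "\<omega> \<in> space ?C"
    then have \<omega>: "\<omega> \<in> space (PiM {0..<Suc n} (\<lambda>_. count_space S))"
      using IT.space_C[OF u, of "Suc n"] by (simp del: IT.C.simps)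
    then have n: "\<omega> n \<in> S" by (auto simp: space_PiM)
    have "(\<integral>\<^sup>+\<omega>'. ?f \<omega>' \<partial>IT.eP (Suc n) \<omega>)
      = (\<integral>\<^sup>+y. ?f (fun_upd \<omega> (Suc n) y) \<partial>point_measure S (\<lambda>y. ennreal (K (\<omega> n) y)))"
      by (subst IT.nn_integral_eP[OF \<omega> m]) (simp add: chain_step_def)
    also have "\<dots> = (\<Sum>y\<in>S. ennreal (K (\<omega> n) y) * ?f (fun_upd \<omega> (Suc n) y))"
      by (rule nn_integral_step[OF n])
    also have "\<dots> = (\<Sum>y\<in>S. ennreal (K (\<omega> n) y) * (if (\<forall>i<n. \<omega> i \<in> F i) \<and> \<omega> n \<in> F n then g y else 0))"
      by (intro sum.cong refl) (auto simp: less_Suc_eq)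
    finally show "(\<integral>\<^sup>+\<omega>'. ?f \<omega>' \<partial>IT.eP (Suc n) \<omega>) = (if \<forall>i<n. \<omega> i \<in> F i then
      (if \<omega> n \<in> F n then \<Sum>y\<in>S. ennreal (K (\<omega> n) y) * g y else 0) else 0)"
      by (simp only: if_conj)
  qed
  also have "\<dots> = box_integral F n (\<lambda>x. if x \<in> F n then \<Sum>y\<in>S. ennreal (K x y) * g y else 0) z"
    unfolding box_integral_def ..
  finally show ?thesis .
qed

text \<open>The law is built from the end of the path, while first-step analysis needs its
  beginning. Peeling off the last step commutes with peeling off the first one, so induction with
  \<open>g\<close> arbitrary converts one recursion into the other.\<close>

lemma box_integral_first_step:
  assumes "z \<in> S"
  shows "box_integral F (Suc n) g z
    = (if z \<in> F 0 then \<Sum>w\<in>S. ennreal (K z w) * box_integral (\<lambda>i. F (Suc i)) n g w else 0)"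
proof (induction n arbitrary: g)
  case 0
  show ?case using assms by (subst box_integral_Suc) (auto simp: box_integral_0)
next
  case (Suc n)
  show ?case
    by (subst box_integral_Suc[OF assms], subst Suc) (auto simp: box_integral_Suc)
qed

lemma emeasure_box:
  assumes "z \<in> S" "\<And>i. F i \<subseteq> S"
  shows "emeasure (path_law S K z) {\<omega> \<in> space path_space. \<forall>i\<le>n. \<omega> i \<in> F i}
    = box_integral F n (indicator (F n)) z"
proof -
  interpret IT: Ionescu_Tulcea "chain_step S K z" "\<lambda>_. count_space S"
    using Ionescu_Tulcea_chain_step[OF finite_S stochastic assms(1)] .
  let ?C = "IT.C 0 (Suc n) (\<lambda>_. undefined)"
  have u: "(\<lambda>_. undefined) \<in> space (PiM {0..<0::nat} (\<lambda>_. count_space S))"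
    by (simp add: space_PiM)
  define X where "X = PiE {0..<Suc n} F"
  have XS: "X \<subseteq> {0..<Suc n} \<rightarrow>\<^sub>E S" unfolding X_def using assms(2) by (rule PiE_mono)
  then have X: "X \<in> sets (PiM {0..<Suc n} (\<lambda>_. count_space S))"
    unfolding PiM_finite_steps by simp
  have "{\<omega> \<in> space path_space. \<forall>i\<le>n. \<omega> i \<in> F i} = IT.PF.emb UNIV {0..<Suc n} X"
    by (auto simp: prod_emb_def X_def space_PiM less_Suc_eq_le Pi_iff)
  then have "emeasure (path_law S K z) {\<omega> \<in> space path_space. \<forall>i\<le>n. \<omega> i \<in> F i}
    = emeasure (IT.CI {0..<Suc n}) X"
    unfolding path_law_def using X by (simp only: IT.lim finite_atLeastLessThan)
  also have "\<dots> = emeasure ?C (IT.PF.emb {0..<Suc n} {0..<Suc n} X)"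
    by (rule IT.emeasure_CI) (use X in auto)
  also have "IT.PF.emb {0..<Suc n} {0..<Suc n} X = X"
    using XS by (intro prod_emb_id) simp
  also have "emeasure ?C X = (\<integral>\<^sup>+\<omega>. indicator X \<omega> \<partial>?C)"
    using X IT.sets_C[OF u, of "Suc n"] by (simp del: IT.C.simps)
  also have "\<dots> = box_integral F n (indicator (F n)) z"
    unfolding box_integral_def
  proof (rule nn_integral_cong)
    fix \<omega> assume "\<omega> \<in> space ?C"
    then have "\<omega> \<in> space (PiM {0..<Suc n} (\<lambda>_. count_space S))"
      using IT.space_C[OF u, of "Suc n"] by (simp del: IT.C.simps)
    then show "indicator X \<omega> = (if \<forall>i<n. \<omega> i \<in> F i then indicator (F n) (\<omega> n) else (0::ennreal))"
      by (auto simp: X_def PiE_iff space_PiM less_Suc_eq split: split_indicator)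
  qed
  finally show ?thesis .
qed

lemma measurable_case_nat_path:
  "z \<in> S \<Longrightarrow> case_nat z \<in> measurable path_space path_space"
  by (rule measurable_PiM_single') (auto simp: space_PiM PiE_iff split: nat.split intro!: measurable_case_nat')

lemma measurable_distr_case_nat:
  assumes z: "z \<in> S"
  shows "(\<lambda>w. distr (path_law S K w) path_space (case_nat z))
    \<in> measurable (point_measure S f) (subprob_algebra path_space)" (is "?D \<in> _")
proof -
  have "?D w \<in> space (subprob_algebra path_space)" if "w \<in> S" for w
    using prob_space.prob_space_distr[OF prob_space_path_law[OF that], of "case_nat z" path_space]
      measurable_case_nat_path[OF z] that
    by (auto simp: space_subprob_algebra measurable_cong_sets[OF sets_path_law refl] prob_space_imp_subprob_space)
  then show ?thesis
    by (subst measurable_cong_sets[OF sets_point_measure_count_space refl]) simp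
qed

text \<open>The Markov property at time 1: draw the next state w, run the chain from w, and put z in
  front. Both sides agree on finite cylinders, which determine a finite measure on the product
  space.\<close>

lemma path_law_first_step:
  assumes z: "z \<in> S"
  shows "path_law S K z = Giry_Monad.bind (point_measure S (\<lambda>y. ennreal (K z y)))
    (\<lambda>w. distr (path_law S K w) path_space (case_nat z))" (is "_ = Giry_Monad.bind ?P ?D")
proof (rule measure_eqI_PiM_infinite[of _ _ "\<lambda>_. count_space S"])
  note Dm = measurable_distr_case_nat[OF z]
  have ne: "space ?P \<noteq> {}" using z by (auto simp: space_point_measure)
  show "sets (path_law S K z) = sets path_space" by (rule sets_path_law[OF z])
  show "sets (Giry_Monad.bind ?P ?D) = sets path_space"
    by (rule sets_bind[OF _ ne]) simp
  show "finite_measure (path_law S K z)"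
    using prob_space_path_law[OF z] by (simp add: prob_space.finite_measure)
  fix A' :: "nat \<Rightarrow> 'a set" and J :: "nat set"
  assume J: "finite J" and A': "\<And>i. i \<in> J \<Longrightarrow> A' i \<in> sets (count_space S)"
  \<comment> \<open>Padding with \<open>S\<close> turns a cylinder over an arbitrary finite index
    set into a box over an initial segment of times.\<close>
  define A where "A i = (if i \<in> J then A' i else S)" for i
  have A: "A i \<subseteq> S" for i using A' by (auto simp: A_def)
  obtain n where n: "J \<subseteq> {..n}"
    using J by (meson finite_nat_iff_bounded_le)
  let ?B = "\<lambda>A n. {\<omega> \<in> space path_space. \<forall>i\<le>n. \<omega> i \<in> A i}"
  have B: "prod_emb UNIV (\<lambda>_. count_space S) J (Pi\<^sub>E J A') = ?B A n"
    using n A' by (fastforce simp: prod_emb_def space_PiM A_def PiE_iff)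
  have Bs: "?B A n \<in> sets path_space"
    unfolding B[symmetric] using A' J by (intro sets_PiM_I) auto
  have "emeasure (Giry_Monad.bind ?P ?D) (?B A n) = (\<Sum>w\<in>S. ennreal (K z w) * emeasure (?D w) (?B A n))"
    by (subst emeasure_bind[OF ne Dm Bs]) (rule nn_integral_step[OF z])
  also have "\<dots> = (\<Sum>w\<in>S. ennreal (K z w) * 
     emeasure (path_law S K w) {\<omega> \<in> space path_space. \<forall>i\<le>n. case_nat z \<omega> i \<in> A i})"
    using Bs measurable_case_nat_path[OF z] z
    by (intro sum.cong refl arg_cong2[where f="(*)"], subst emeasure_distr)
       (auto simp: measurable_cong_sets[OF sets_path_law refl] space_path_law space_path_space
         intro!: arg_cong2[where f=emeasure] split: nat.split)
  also have "\<dots> = box_integral A n (indicator (A n)) z"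
  proof (cases n)
    \<comment> \<open>The box constrains only the prepended state z, so the average over
      \<open>w\<close> collapses because the row of \<open>K\<close> sums to 1.\<close>
    case 0
    have "{\<omega> \<in> space path_space. z \<in> A 0} = (if z \<in> A 0 then space path_space else {})" by auto
    then have "emeasure (path_law S K w) {\<omega> \<in> space path_space. z \<in> A 0} = indicator (A 0) z" if "w \<in> S" for w
      using prob_space.emeasure_space_1[OF prob_space_path_law[OF that]] that
      by (auto simp: space_path_law space_path_space)
    then show ?thesis using 0 z K_nonneg K_sum
      by (simp add: box_integral_0 sum_distrib_right[symmetric])
  next
    case (Suc m)
    have "{\<omega> \<in> space path_space. \<forall>i\<le>n. case_nat z \<omega> i \<in> A i}
      = (if z \<in> A 0 then ?B (\<lambda>i. A (Suc i)) m else {})"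
      unfolding Suc by (auto simp: split: nat.splits elim: allE[of _ "Suc _"])
    then show ?thesis
      using A by (simp add: Suc box_integral_first_step[OF z] emeasure_box)
  qed
  also have "\<dots> = emeasure (path_law S K z) (?B A n)"
    by (rule emeasure_box[symmetric, OF z A])
  finally show "emeasure (path_law S K z) (prod_emb UNIV (\<lambda>_. count_space S) J (Pi\<^sub>E J A')) =
    emeasure (Giry_Monad.bind ?P ?D) (prod_emb UNIV (\<lambda>_. count_space S) J (Pi\<^sub>E J A'))"
    unfolding B by simp
qed

text \<open>The form in which the Markov property is used from here on: rewriting
  \<open>Q (case_nat z \<omega>)\<close> as an event of the shifted path gives a recursion for the
  probability of \<open>Q\<close>.\<close>

lemma prob_first_step:
  assumes z: "z \<in> S" and Q: "Measurable.pred path_space Q"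
  shows "\<P>(\<omega> in path_law S K z. Q \<omega>)
    = (\<Sum>w\<in>S. K z w * \<P>(\<omega> in path_law S K w. Q (case_nat z \<omega>)))"
proof -
  let ?P = "point_measure S (\<lambda>y. ennreal (K z y))"
  let ?D = "\<lambda>w. distr (path_law S K w) path_space (case_nat z)"
  let ?E = "{\<omega> \<in> space path_space. Q \<omega>}"
  have E: "?E \<in> sets path_space" using Q by simp
  note Dm = measurable_distr_case_nat[OF z]
  have ne: "space ?P \<noteq> {}" using z by (auto simp: space_point_measure)
  have "emeasure (path_law S K z) ?E = (\<Sum>w\<in>S. ennreal (K z w) * emeasure (?D w) ?E)"
    by (subst path_law_first_step[OF z], subst emeasure_bind[OF ne Dm E]) (rule nn_integral_step[OF z])
  also have "\<dots> = (\<Sum>w\<in>S. ennreal (K z w) * 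
     emeasure (path_law S K w) {\<omega> \<in> space (path_law S K w). Q (case_nat z \<omega>)})"
    using E measurable_case_nat_path[OF z] z
    by (intro sum.cong refl arg_cong2[where f="(*)"], subst emeasure_distr)
       (auto simp: measurable_cong_sets[OF sets_path_law refl] space_path_law space_path_space
         intro!: arg_cong2[where f=emeasure] split: nat.split)
  also have "\<dots> = ennreal (\<Sum>w\<in>S. K z w * \<P>(\<omega> in path_law S K w. Q (case_nat z \<omega>)))"
    using z by (subst sum_ennreal[symmetric])
      (auto simp: K_nonneg ennreal_mult' finite_measure.emeasure_eq_measure[OF prob_space.finite_measure]
        prob_space_path_law)
  finally show ?thesis
    using z K_nonneg
    by (simp add: finite_measure.emeasure_eq_measure[OF prob_space.finite_measure] prob_space_path_law
      space_path_law space_path_space sum_nonneg)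
qed

section \<open>Marginals at a fixed time\<close>

lemma pred_coordinate_in [measurable]: "Measurable.pred path_space (\<lambda>\<omega>. \<omega> t \<in> A)"
proof (rule measurable_compose[where N="count_space S" and g="\<lambda>x. x \<in> A"])
  show "(\<lambda>\<omega>. \<omega> t) \<in> path_space \<rightarrow>\<^sub>M count_space S"
    by (intro measurable_component_singleton) simp
qed simp

lemma pred_coordinate_eq [measurable]: "Measurable.pred path_space (\<lambda>\<omega>. \<omega> t = y)"
  using pred_coordinate_in[of t "{y}"] by simp

lemma measure_path_law_space [simp]: "z \<in> S \<Longrightarrow> measure (path_law S K z) (space (path_law S K z)) = 1"
  by (rule prob_space.prob_space[OF prob_space_path_law])

lemma prob_const: "z \<in> S \<Longrightarrow> \<P>(\<omega> in path_law S K z. c) = of_bool c"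
  by (cases c) auto

lemma prob_coordinate_0: "z \<in> S \<Longrightarrow> \<P>(\<omega> in path_law S K z. \<omega> 0 \<in> A) = of_bool (z \<in> A)"
  by (subst prob_first_step, simp, simp, cases "z \<in> A") (simp_all add: prob_const K_sum)

lemma prob_coordinate_Suc:
  "z \<in> S \<Longrightarrow> \<P>(\<omega> in path_law S K z. \<omega> (Suc t) \<in> A) = (\<Sum>w\<in>S. K z w * \<P>(\<omega> in path_law S K w. \<omega> t \<in> A))"
  by (subst prob_first_step[OF _ pred_coordinate_in]) simp_all

lemma stationary_prob_coordinate:
  assumes "is_stationary S K \<pi>"
  shows "(\<Sum>x\<in>S. \<pi> x * \<P>(\<omega> in path_law S K x. \<omega> t \<in> A)) = (\<Sum>x\<in>S \<inter> A. \<pi> x)"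
proof (induction t)
  case 0
  show ?case
  proof -
    have "(\<Sum>x\<in>S. \<pi> x * \<P>(\<omega> in path_law S K x. \<omega> 0 \<in> A)) = (\<Sum>x\<in>S. if x \<in> A then \<pi> x else 0)"
    proof (rule sum.cong)
      fix x assume "x \<in> S"
      show "\<pi> x * \<P>(\<omega> in path_law S K x. \<omega> 0 \<in> A) = (if x \<in> A then \<pi> x else 0)"
        unfolding prob_coordinate_0[OF \<open>x \<in> S\<close>] by simp
    qed simp
    then show ?thesis by (simp only: sum.inter_restrict[OF finite_S])
  qed
next
  case (Suc t)
  let ?p = "\<lambda>w. \<P>(\<omega> in path_law S K w. \<omega> t \<in> A)"
  have "(\<Sum>x\<in>S. \<pi> x * \<P>(\<omega> in path_law S K x. \<omega> (Suc t) \<in> A)) = (\<Sum>x\<in>S. \<Sum>w\<in>S. \<pi> x * K x w * ?p w)"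
    by (simp add: prob_coordinate_Suc sum_distrib_left mult.assoc cong: sum.cong)
  also have "\<dots> = (\<Sum>w\<in>S. (\<Sum>x\<in>S. \<pi> x * K x w) * ?p w)"
    unfolding sum_distrib_right by (rule sum.swap)
  also have "\<dots> = (\<Sum>w\<in>S. \<pi> w * ?p w)"
  proof (rule sum.cong)
    fix w assume "w \<in> S"
    then have "(\<Sum>x\<in>S. \<pi> x * K x w) = \<pi> w" using assms by (auto simp: is_stationary_def)
    then show "(\<Sum>x\<in>S. \<pi> x * K x w) * ?p w = \<pi> w * ?p w" by (simp only:)
  qed simp
  also note Suc
  finally show ?case .
qed

subsection \<open>Occupation and hitting times\<close>

text \<open>\<open>N\<close> is a number of instants, not a final time, so that the count starts
  from 0 and shifts cleanly along \<open>case_nat\<close>. The occupation time up to time s covers s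
  + 1 instants.\<close>

definition visits :: "'a set \<Rightarrow> nat \<Rightarrow> (nat \<Rightarrow> 'a) \<Rightarrow> nat" where
  "visits B N \<omega> = (\<Sum>u<N. of_bool (\<omega> u \<in> B))"

lemma measurable_visits [measurable]: "visits B N \<in> path_space \<rightarrow>\<^sub>M count_space UNIV"
  unfolding visits_def[abs_def] of_bool_def by measurable

lemma visits_Suc_case_nat: "visits B (Suc N) (case_nat z \<omega>) = of_bool (z \<in> B) + visits B N \<omega>"
  unfolding visits_def by (subst sum.lessThan_Suc_shift) simp

lemma visits_0 [simp]: "visits B 0 \<omega> = 0"
  by (simp add: visits_def)

lemma mono_visits: "M \<le> N \<Longrightarrow> visits B M \<omega> \<le> visits B N \<omega>"
  unfolding visits_def by (intro sum_mono2) auto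

lemma occupation_time_eq_visits: "occupation_time B s \<omega> = visits B (Suc s) \<omega>"
proof -
  have "{u. u \<le> s \<and> \<omega> u \<in> B} = {u \<in> {..<Suc s}. \<omega> u \<in> B}" by auto
  then show ?thesis
    unfolding occupation_time_def visits_def by (simp only: card_eq_sum sum.inter_filter[OF finite_lessThan] of_bool_def)
qed

text \<open>The instance N = 0 holds trivially because the bound \<open>Suc t\<close> is positive,
  so only successors matter and the shift applies to each of them.\<close>

lemma all_visits_case_nat:
  "(\<forall>N. visits B N (case_nat z \<omega>) < Suc t) \<longleftrightarrow> (\<forall>N. of_bool (z \<in> B) + visits B N \<omega> < Suc t)"
proof -
  have "(\<forall>N. P N) \<longleftrightarrow> P 0 \<and> (\<forall>N. P (Suc N))" for P :: "nat \<Rightarrow> bool"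
    by (metis not0_implies_Suc)
  from this[of "\<lambda>N. visits B N (case_nat z \<omega>) < Suc t"] show ?thesis
    by (simp add: visits_Suc_case_nat)
qed

text \<open>The instants are 0 to N - 1; missing a set up to and including time T is therefore
  \<open>miss_prob A (Suc T)\<close>.\<close>

definition miss_prob :: "'a set \<Rightarrow> nat \<Rightarrow> 'a \<Rightarrow> real" where
  "miss_prob A N z = \<P>(\<omega> in path_law S K z. \<forall>u<N. \<omega> u \<notin> A)"

lemma miss_prob_0: "z \<in> S \<Longrightarrow> miss_prob A 0 z = 1"
  by (simp add: miss_prob_def prob_const[of _ True, simplified])

lemma all_less_Suc_case_nat: "(\<forall>u<Suc N. P (case_nat z \<omega> u)) \<longleftrightarrow> P z \<and> (\<forall>u<N. P (\<omega> u))"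
  by (auto simp: less_Suc_eq_0_disj)

lemma miss_prob_Suc:
  assumes "z \<in> S"
  shows "miss_prob A (Suc N) z = of_bool (z \<notin> A) * (\<Sum>w\<in>S. K z w * miss_prob A N w)"
proof -
  have "miss_prob A (Suc N) z = (\<Sum>w\<in>S. K z w * \<P>(\<omega> in path_law S K w. z \<notin> A \<and> (\<forall>u<N. \<omega> u \<notin> A)))"
    unfolding miss_prob_def
    by (subst prob_first_step[OF assms]) (measurable, simp only: all_less_Suc_case_nat[of N "\<lambda>x. x \<notin> A"])
  then show ?thesis
    by (cases "z \<in> A") (simp_all add: miss_prob_def)
qed

text \<open>Paths never leave \<open>S\<close>. This allows a target chosen for the whole chain to
  be used for the trace chain, whose hitting bounds speak only of subsets of its own
  carrier.\<close>

lemma miss_prob_Int: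
  "z \<in> S \<Longrightarrow> miss_prob (A \<inter> S) N z = miss_prob A N z"
proof (induction N arbitrary: z)
  case (Suc N)
  have "(\<Sum>w\<in>S. K z w * miss_prob (A \<inter> S) N w) = (\<Sum>w\<in>S. K z w * miss_prob A N w)"
    by (rule sum.cong[OF refl]) (simp only: Suc.IH)
  moreover have "z \<in> A \<inter> S \<longleftrightarrow> z \<in> A" using Suc.prems by blast
  ultimately show ?case unfolding miss_prob_Suc[OF Suc.prems] by (simp only:)
qed (simp add: miss_prob_0)

lemma miss_prob_nonneg [simp]: "0 \<le> miss_prob A N z"
  by (simp add: miss_prob_def)

lemma miss_prob_le_1: "z \<in> S \<Longrightarrow> miss_prob A N z \<le> 1"
  unfolding miss_prob_def by (intro prob_space.prob_le_1 prob_space_path_law)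

lemma miss_prob_antimono:
  assumes "z \<in> S" "M \<le> N"
  shows "miss_prob A N z \<le> miss_prob A M z"
  unfolding miss_prob_def
proof (rule finite_measure.finite_measure_mono)
  show "finite_measure (path_law S K z)"
    using prob_space_path_law[OF assms(1)] by (simp add: prob_space.finite_measure)
  have "Measurable.pred path_space (\<lambda>\<omega>. \<forall>u<M. \<omega> u \<notin> A)" by measurable
  then have "{\<omega> \<in> space path_space. \<forall>u<M. \<omega> u \<notin> A} \<in> sets path_space" by (simp only: pred_def)
  then show "{\<omega> \<in> space (path_law S K z). \<forall>u<M. \<omega> u \<notin> A} \<in> sets (path_law S K z)"
    using assms(1) by (simp only: sets_path_law space_path_law space_path_space)
  show "{\<omega> \<in> space (path_law S K z). \<forall>u<N. \<omega> u \<notin> A} \<subseteq> {\<omega> \<in> space (path_law S K z). \<forall>u<M. \<omega> u \<notin> A}"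
    using less_le_trans[OF _ assms(2)] by blast
qed

text \<open>Windows of a + 1 and b + 1 instants that share instant a cover a + b + 1 instants. Given
  the state at the shared instant, the second window costs a factor of at most M; induction on
  \<open>a\<close> by first steps replaces conditioning at time a.\<close>

lemma miss_prob_add:
  assumes "z \<in> S" and M: "\<And>x. x \<in> S \<Longrightarrow> miss_prob A (Suc b) x \<le> M"
  shows "miss_prob A (Suc (a + b)) z \<le> miss_prob A (Suc a) z * M"
  using assms(1)
proof (induction a arbitrary: z)
  case 0
  have "miss_prob A (Suc 0) z = of_bool (z \<notin> A)"
    using 0 by (simp add: miss_prob_Suc miss_prob_0 K_sum)
  moreover have "miss_prob A (Suc b) z = 0" if "z \<in> A" using that 0 by (simp add: miss_prob_Suc)
  ultimately show ?case using M[OF 0] by (cases "z \<in> A") simp_all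
next
  case (Suc a)
  have "(\<Sum>w\<in>S. K z w * miss_prob A (Suc (a + b)) w) \<le> (\<Sum>w\<in>S. K z w * (miss_prob A (Suc a) w * M))"
    using Suc by (intro sum_mono mult_left_mono K_nonneg) auto
  also have "\<dots> = (\<Sum>w\<in>S. K z w * miss_prob A (Suc a) w) * M"
    by (simp add: sum_distrib_right mult.assoc)
  finally show ?case
    unfolding add_Suc miss_prob_Suc[OF Suc.prems, of A "Suc _"] by (cases "z \<in> A") simp_all
qed

text \<open>Since neighbouring blocks share an instant, k blocks of T + 1 instants cover k T + 1
  instants.\<close>

lemma miss_prob_power:
  assumes "z \<in> S" and M: "\<And>x. x \<in> S \<Longrightarrow> miss_prob A (Suc T) x \<le> M"
  shows "miss_prob A (Suc (k * T)) z \<le> M ^ k"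
  using assms(1)
proof (induction k arbitrary: z)
  case 0
  then show ?case by (simp add: miss_prob_le_1)
next
  case (Suc k)
  have M0: "0 \<le> M" using order_trans[OF miss_prob_nonneg M[OF Suc.prems]] .
  have "miss_prob A (Suc (Suc k * T)) z \<le> miss_prob A (Suc (k * T)) z * M"
    using miss_prob_add[where a="k * T" and b=T, OF Suc.prems M] by (simp add: add.commute)
  also have "\<dots> \<le> M ^ k * M" using Suc M0 by (intro mult_right_mono) auto
  finally show ?case by (simp add: mult.commute)
qed

section \<open>Expected hitting times as sums of miss probabilities\<close>

lemma less_hitting_time_iff: "enat t < hitting_time A \<omega> \<longleftrightarrow> (\<forall>u<Suc t. \<omega> u \<notin> A)"
proof
  assume *: "enat t < hitting_time A \<omega>"
  show "\<forall>u<Suc t. \<omega> u \<notin> A"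
  proof (intro allI impI notI)
    fix u assume "u < Suc t" "\<omega> u \<in> A"
    then have "hitting_time A \<omega> \<le> enat u" unfolding hitting_time_def by (intro INF_lower) auto
    with * have "enat t < enat u" by (rule less_le_trans)
    with \<open>u < Suc t\<close> show False by simp
  qed
next
  assume *: "\<forall>u<Suc t. \<omega> u \<notin> A"
  have "enat (Suc t) \<le> hitting_time A \<omega>"
    unfolding hitting_time_def proof (rule INF_greatest)
    fix u assume "u \<in> {t. \<omega> t \<in> A}"
    with * have "\<not> u < Suc t" by blast
    then show "enat (Suc t) \<le> enat u" by simp
  qed
  moreover have "enat t < enat (Suc t)" by simp
  ultimately show "enat t < hitting_time A \<omega>" by (rule less_le_trans[rotated])
qed

text \<open>A form of the infimum from which measurability can be derived.\<close>

lemma hitting_time_eq: "hitting_time A \<omega> = (if \<exists>t. \<omega> t \<in> A then enat (LEAST t. \<omega> t \<in> A) else \<infinity>)"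
proof (cases "\<exists>t. \<omega> t \<in> A")
  case True
  let ?l = "LEAST t. \<omega> t \<in> A"
  have "\<omega> ?l \<in> A" using True by (rule LeastI_ex)
  then have "hitting_time A \<omega> \<le> enat ?l"
    unfolding hitting_time_def by (intro INF_lower) simp
  moreover have "enat ?l \<le> hitting_time A \<omega>"
    unfolding hitting_time_def
  proof (rule INF_greatest)
    fix t assume "t \<in> {t. \<omega> t \<in> A}"
    then have "?l \<le> t" by (intro Least_le) simp
    then show "enat ?l \<le> enat t" by simp
  qed
  ultimately show ?thesis using True by (simp only: if_True antisym)
next
  case False
  then have "{t. \<omega> t \<in> A} = {}" by blast
  then show ?thesis using False unfolding hitting_time_def by (simp only: image_empty Inf_empty top_enat_def if_False)
qed

lemma measurable_hitting_time: "hitting_time A \<in> path_space \<rightarrow>\<^sub>M count_space UNIV"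
  unfolding hitting_time_eq[abs_def] by measurable

text \<open>The tail-sum formula: the hitting time exceeds s exactly when the s + 1 instants 0 to s
  all miss \<open>A\<close>.\<close>

lemma expected_hitting_time:
  assumes "z \<in> S"
  shows "(\<integral>\<^sup>+\<omega>. ennreal_of_enat (hitting_time A \<omega>) \<partial>path_law S K z) = (\<Sum>s. ennreal (miss_prob A (Suc s) z))"
proof -
  have "hitting_time A \<in> path_law S K z \<rightarrow>\<^sub>M count_space UNIV"
    using measurable_hitting_time by (simp add: measurable_cong_sets[OF sets_path_law[OF assms] refl])
  then show ?thesis
    by (subst nn_integral_enat_function)
      (simp_all add: less_hitting_time_iff miss_prob_def
        finite_measure.emeasure_eq_measure[OF prob_space.finite_measure[OF prob_space_path_law[OF assms]]])
qed

text \<open>The miss probabilities are bounded by \<open>M ^ k\<close> on the block \<open>{k * T..<Suc k * T}\<close> of times.\<close>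

lemma expected_hitting_time_le:
  assumes "z \<in> S" "0 < T" "M < 1" and M: "\<And>x. x \<in> S \<Longrightarrow> miss_prob A (Suc T) x \<le> M"
  shows "(\<integral>\<^sup>+\<omega>. ennreal_of_enat (hitting_time A \<omega>) \<partial>path_law S K z) \<le> ennreal (real T / (1 - M))"
proof -
  have M0: "0 \<le> M" using order_trans[OF miss_prob_nonneg M[OF assms(1)]] .
  have 1: "(\<Sum>s<n * T. miss_prob A (Suc s) z) \<le> real T * (\<Sum>k<n. M ^ k)" for n
  proof (induction n)
    case (Suc n)
    have "(\<Sum>s<Suc n * T. miss_prob A (Suc s) z)
        = (\<Sum>s<n * T. miss_prob A (Suc s) z) + (\<Sum>s\<in>{n * T..<Suc n * T}. miss_prob A (Suc s) z)"
      by (subst sum.union_disjoint[symmetric]) (auto intro!: sum.cong)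
    also have "(\<Sum>s\<in>{n * T..<Suc n * T}. miss_prob A (Suc s) z) \<le> (\<Sum>s\<in>{n * T..<Suc n * T}. M ^ n)"
      using miss_prob_power[OF assms(1) M, of n]
      by (intro sum_mono) (auto intro: order_trans[OF miss_prob_antimono[OF assms(1)]])
    also have "\<dots> = real T * M ^ n" by simp
    finally show ?case using Suc by (simp add: algebra_simps)
  qed simp
  have 2: "(\<Sum>s<n. miss_prob A (Suc s) z) \<le> real T / (1 - M)" for n
  proof -
    have "(\<Sum>s<n. miss_prob A (Suc s) z) \<le> (\<Sum>s<n * T. miss_prob A (Suc s) z)"
      using assms(2) by (intro sum_mono2) auto
    also have "\<dots> \<le> real T * (\<Sum>k<n. M ^ k)" by (rule 1)
    also have "(\<Sum>k<n. M ^ k) \<le> 1 / (1 - M)"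
      using assms(3) M0 by (subst sum_gp_strict) (simp add: divide_right_mono)
    finally show ?thesis by (simp add: mult_left_mono)
  qed
  have "(\<Sum>s. ennreal (miss_prob A (Suc s) z)) \<le> ennreal (real T / (1 - M))"
    using 2 by (intro suminf_le_const) (auto simp: sum_ennreal ennreal_leI)
  then show ?thesis by (simp add: expected_hitting_time[OF assms(1)])
qed

text \<open>Markov's inequality, read off the tail sum: by monotonicity each of its first t terms is
  at least \<open>miss_prob A t z\<close>.\<close>

lemma miss_prob_le_expected_hitting_time:
  assumes "z \<in> S"
  shows "ennreal (real t * miss_prob A t z) \<le> (\<integral>\<^sup>+\<omega>. ennreal_of_enat (hitting_time A \<omega>) \<partial>path_law S K z)"
proof -
  have "real t * miss_prob A t z = (\<Sum>s<t. miss_prob A t z)" by simp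
  also have "\<dots> \<le> (\<Sum>s<t. miss_prob A (Suc s) z)"
    using assms by (intro sum_mono miss_prob_antimono) auto
  finally have "ennreal (real t * miss_prob A t z) \<le> (\<Sum>s<t. ennreal (miss_prob A (Suc s) z))"
    by (simp add: sum_ennreal ennreal_leI)
  also have "\<dots> \<le> (\<Sum>s. ennreal (miss_prob A (Suc s) z))"
    by (intro sum_le_suminf) auto
  finally show ?thesis by (simp add: expected_hitting_time[OF assms])
qed

end

section \<open>Minimum principle, uniqueness of the stationary law and recurrence\<close>

locale irreducible_chain = finite_chain +
  assumes irreducible: "irreducible_on S K"
begin

text \<open>A function superharmonic off \<open>B\<close> takes its minimum over \<open>S\<close>
  somewhere. At a minimiser outside \<open>B\<close> the average over the next state cannot exceed
  the minimum, so all states reachable in one step are minimisers too. Irreducibility carries this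
  along a path until it meets \<open>B\<close>, where \<open>m\<close> is a lower bound.\<close>

lemma minimum_principle:
  assumes "B \<subseteq> S" "B \<noteq> {}"
    and super: "\<And>x. x \<in> S - B \<Longrightarrow> (\<Sum>y\<in>S. K x y * f y) \<le> f x"
    and bound: "\<And>x. x \<in> B \<Longrightarrow> m \<le> f x"
    and "x \<in> S"
  shows "m \<le> f x"
proof -
  define \<mu> where "\<mu> = Min (f ` S)"
  have le: "\<mu> \<le> f y" if "y \<in> S" for y
    unfolding \<mu>_def using finite_S that by simp
  have "\<mu> \<in> f ` S" unfolding \<mu>_def using finite_S \<open>x \<in> S\<close> by (intro Min_in) auto
  then obtain a where a: "a \<in> S" "f a = \<mu>" by blast
  obtain b where b: "b \<in> B" "b \<in> S" using assms(1,2) by blast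
  obtain t where t: "0 < \<P>(\<omega> in path_law S K a. \<omega> t \<in> {b})"
    using irreducible a b by (auto simp: irreducible_on_def)
  have "m \<le> \<mu>" if "y \<in> S" "f y = \<mu>" "0 < \<P>(\<omega> in path_law S K y. \<omega> t \<in> {b})" for y t
    using that
  proof (induction t arbitrary: y)
    case 0
    have "\<P>(\<omega> in path_law S K y. \<omega> 0 \<in> {b}) = of_bool (y \<in> {b})"
      by (rule prob_coordinate_0[OF 0(1)])
    with 0 have "y = b" by (auto split: if_splits)
    then show ?case using bound[OF b(1)] 0 by simp
  next
    case (Suc t)
    show ?case
    proof (cases "y \<in> B")
      case True
      then show ?thesis using bound Suc.prems by fastforce
    next
      case False
      have "0 < (\<Sum>w\<in>S. K y w * \<P>(\<omega> in path_law S K w. \<omega> t \<in> {b}))"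
        using Suc.prems(3) unfolding prob_coordinate_Suc[OF Suc.prems(1)] .
      then obtain w where w: "w \<in> S" "K y w * \<P>(\<omega> in path_law S K w. \<omega> t \<in> {b}) > 0"
        by (meson not_le sum_nonpos)
      then have Kw: "K y w > 0" and pw: "\<P>(\<omega> in path_law S K w. \<omega> t \<in> {b}) > 0"
        using K_nonneg[OF Suc.prems(1) w(1)] by (auto simp: zero_less_mult_iff)
      \<comment> \<open>These terms are nonnegative and sum to at most 0, so each vanishes; since
        \<open>K y w\<close> is positive, \<open>w\<close> is again a minimiser.\<close>
      have nn: "0 \<le> K y v * (f v - \<mu>)" if "v \<in> S" for v
        using K_nonneg[OF Suc.prems(1) that] le[OF that] by simp
      have "(\<Sum>v\<in>S. K y v * (f v - \<mu>)) = (\<Sum>v\<in>S. K y v * f v) - \<mu>"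
        using K_sum[OF Suc.prems(1)] by (simp add: right_diff_distrib sum_subtractf sum_distrib_right[symmetric])
      also have "\<dots> \<le> 0" using super[of y] False Suc.prems by simp
      finally have "(\<Sum>v\<in>S. K y v * (f v - \<mu>)) = 0" using sum_nonneg[OF nn] by fastforce
      then have "K y w * (f w - \<mu>) = 0"
        using sum_nonneg_eq_0_iff[OF finite_S, of "\<lambda>v. K y v * (f v - \<mu>)"] nn w(1) by blast
      then have "f w = \<mu>" using Kw by simp
      with Suc.IH w(1) pw show ?thesis by blast
    qed
  qed
  from this[OF a t] le[OF \<open>x \<in> S\<close>] show ?thesis by simp
qed

text \<open>Some state has positive mass, and with positive probability it leads to \<open>y\<close>
  at a suitable time, at which the law is still \<pi>.\<close>

lemma stationary_pos:
  assumes "is_stationary S K \<pi>" "y \<in> S"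
  shows "0 < \<pi> y"
proof -
  have nn: "\<And>x. x \<in> S \<Longrightarrow> 0 \<le> \<pi> x" and "(\<Sum>x\<in>S. \<pi> x) = 1"
    using assms(1) by (auto simp: is_stationary_def)
  then have "0 < (\<Sum>x\<in>S. \<pi> x)" by simp
  then obtain x where x: "x \<in> S" "0 < \<pi> x" by (meson not_le sum_nonpos)
  obtain t where t: "0 < \<P>(\<omega> in path_law S K x. \<omega> t \<in> {y})"
    using irreducible x assms(2) by (auto simp: irreducible_on_def)
  have "0 < (\<Sum>x\<in>S. \<pi> x * \<P>(\<omega> in path_law S K x. \<omega> t \<in> {y}))"
    using x t nn finite_S by (intro sum_pos2[of _ x]) (auto intro: mult_nonneg_nonneg measure_nonneg)
  also have "\<dots> = (\<Sum>x\<in>S \<inter> {y}. \<pi> x)" by (rule stationary_prob_coordinate[OF assms(1)])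
  finally show ?thesis using assms(2) by simp
qed

text \<open>By reversibility the density \<mu>/\<pi> is harmonic on all of \<open>S\<close>. The
  minimum principle relative to each singleton makes it constant, and normalisation makes the
  constant 1. This identifies the definite description \<open>stationary_dist\<close>.\<close>

lemma reversible_stationary_unique:
  assumes \<pi>: "is_stationary S K \<pi>" and \<mu>: "is_stationary S K \<mu>"
    and rev: "\<And>x y. x \<in> S \<Longrightarrow> y \<in> S \<Longrightarrow> \<pi> x * K x y = \<pi> y * K y x"
  shows "\<mu> = \<pi>"
proof -
  note pos = stationary_pos[OF \<pi>]
  define f where "f x = \<mu> x / \<pi> x" for x
  have harm: "(\<Sum>y\<in>S. K x y * f y) = f x" if "x \<in> S" for x
  proof -
    have "(\<Sum>y\<in>S. K x y * f y) = (\<Sum>y\<in>S. \<mu> y * K y x) / \<pi> x"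
      unfolding sum_divide_distrib f_def
    proof (rule sum.cong)
      fix y assume "y \<in> S"
      then show "K x y * (\<mu> y / \<pi> y) = \<mu> y * K y x / \<pi> x"
        using rev[OF that \<open>y \<in> S\<close>] pos[OF that] pos[of y] by (simp add: field_simps)
    qed simp
    also have "\<dots> = f x" using \<mu> that by (simp add: is_stationary_def f_def)
    finally show ?thesis .
  qed
  have le: "f y \<le> f x" if "x \<in> S" "y \<in> S" for x y
    using minimum_principle[of "{y}" f "f y" x] that harm by auto
  have "\<mu> x = \<pi> x" if "x \<in> S" for x
  proof -
    have eq: "\<mu> y = f x * \<pi> y" if "y \<in> S" for y
      using le[of x y] le[of y x] \<open>x \<in> S\<close> that pos[OF that] by (simp add: f_def field_simps)
    have "1 = (\<Sum>y\<in>S. \<mu> y)" using \<mu> by (simp add: is_stationary_def)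
    also have "\<dots> = f x * (\<Sum>y\<in>S. \<pi> y)" unfolding sum_distrib_left by (intro sum.cong refl eq)
    also have "\<dots> = f x" using \<pi> by (simp add: is_stationary_def)
    finally show ?thesis using eq[OF that] by simp
  qed
  moreover have "\<mu> x = \<pi> x" if "x \<notin> S" for x
    using \<pi> \<mu> that by (simp add: is_stationary_def)
  ultimately show ?thesis by (intro ext) blast
qed

text \<open>Recurrence, by induction on the number of visits. Off \<open>B\<close> the probability
  is harmonic; on \<open>B\<close> the current instant uses up one visit, so the induction
  hypothesis makes it 0. The minimum principle for its negative then gives the upper bound 0
  everywhere.\<close>

lemma prob_finitely_many_visits:
  assumes B: "B \<subseteq> S" "B \<noteq> {}" and "z \<in> S"
  shows "\<P>(\<omega> in path_law S K z. \<forall>N. visits B N \<omega> < t) = 0"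
  using \<open>z \<in> S\<close>
proof (induction t arbitrary: z)
  case 0
  then show ?case by simp
next
  case (Suc t)
  let ?u = "\<lambda>z. \<P>(\<omega> in path_law S K z. \<forall>N. visits B N \<omega> < Suc t)"
  have step: "?u z = (\<Sum>w\<in>S. K z w * \<P>(\<omega> in path_law S K w. \<forall>N. of_bool (z \<in> B) + visits B N \<omega> < Suc t))"
    if "z \<in> S" for z
  proof -
    have "Measurable.pred path_space (\<lambda>\<omega>. \<forall>N. visits B N \<omega> < Suc t)" by measurable
    from prob_first_step[OF that this] show ?thesis unfolding all_visits_case_nat .
  qed
  have "0 \<le> - ?u z"
  proof (rule minimum_principle[OF B])
    fix x assume "x \<in> S - B"
    then show "(\<Sum>y\<in>S. K x y * - ?u y) \<le> - ?u x"
      using step[of x] by (simp add: sum_negf)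
  next
    fix x assume "x \<in> B"
    then have "x \<in> S" using B by blast
    have "?u x = (\<Sum>w\<in>S. K x w * \<P>(\<omega> in path_law S K w. \<forall>N. visits B N \<omega> < t))"
      using step[OF \<open>x \<in> S\<close>] \<open>x \<in> B\<close> by simp
    also have "\<dots> = 0" using Suc.IH by simp
    finally show "0 \<le> - ?u x" by simp
  qed (rule Suc.prems)
  then show ?case using measure_nonneg[of "path_law S K z"] by (simp add: antisym)
qed

text \<open>Continuity from above turns recurrence into a statement about finite horizons, as needed
  to see that some T satisfies the condition defining the partition time.\<close>

lemma few_visits_tendsto_0:
  assumes B: "B \<subseteq> S" "B \<noteq> {}" and "z \<in> S"
  shows "(\<lambda>N. \<P>(\<omega> in path_law S K z. visits B N \<omega> < t)) \<longlonglongrightarrow> 0"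
proof -
  let ?A = "\<lambda>N. {\<omega> \<in> space (path_law S K z). visits B N \<omega> < t}"
  interpret prob_space "path_law S K z" by (rule prob_space_path_law[OF \<open>z \<in> S\<close>])
  have "?A N \<in> events" for N
  proof -
    have "Measurable.pred path_space (\<lambda>\<omega>. visits B N \<omega> < t)" by measurable
    then have "{\<omega> \<in> space path_space. visits B N \<omega> < t} \<in> sets path_space" by (simp only: pred_def)
    then show ?thesis
      using assms(3) by (simp only: sets_path_law space_path_law space_path_space)
  qed
  moreover have "decseq ?A"
    unfolding decseq_def using order.strict_trans1[OF mono_visits] by blast
  ultimately have "(\<lambda>N. prob (?A N)) \<longlonglongrightarrow> prob (\<Inter>N. ?A N)"
    by (intro finite_Lim_measure_decseq) auto
  also have "(\<Inter>N. ?A N) = {\<omega> \<in> space (path_law S K z). \<forall>N. visits B N \<omega> < t}" by auto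
  finally show ?thesis using prob_finitely_many_visits[OF assms] by simp
qed

subsection \<open>The trace chain\<close>

text \<open>For y in \<open>B\<close> this is the probability that y is the first point of
  \<open>B\<close> on the path, that is, the harmonic measure of \<open>B\<close> seen from z. Time
  0 counts here, whereas the trace kernel waits for a time at least 1.\<close>

definition hit_prob :: "'a set \<Rightarrow> 'a \<Rightarrow> 'a \<Rightarrow> real" where
  "hit_prob B z y = \<P>(\<omega> in path_law S K z. \<exists>t. \<omega> t = y \<and> (\<forall>s<t. \<omega> s \<notin> B))"

lemma hit_prob_nonneg [simp]: "0 \<le> hit_prob B z y"
  by (simp add: hit_prob_def)

lemma hit_prob_in:
  assumes "z \<in> S" "z \<in> B" "y \<in> B"
  shows "hit_prob B z y = of_bool (z = y)"
proof -
  have eq: "(\<exists>t. case_nat z \<omega> t = y \<and> (\<forall>s<t. case_nat z \<omega> s \<notin> B)) \<longleftrightarrow> z = y"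
    (is "?L \<longleftrightarrow> ?R") for \<omega>
  proof
    assume ?L
    then obtain t where t: "case_nat z \<omega> t = y" "\<forall>s<t. case_nat z \<omega> s \<notin> B" by blast
    show ?R
    proof (cases t)
      case (Suc u)
      then show ?thesis using t(2)[rule_format, of 0] assms(2) by simp
    qed (use t(1) in simp)
  next
    assume ?R
    then show ?L by (intro exI[of _ 0]) simp
  qed
  have "Measurable.pred path_space (\<lambda>\<omega>. \<exists>t. \<omega> t = y \<and> (\<forall>s<t. \<omega> s \<notin> B))" by measurable
  from prob_first_step[OF assms(1) this] show ?thesis
    unfolding hit_prob_def eq using K_sum[OF assms(1)] by (cases "z = y") simp_all
qed

lemma hit_prob_notin:
  assumes "z \<in> S" "z \<notin> B" "y \<in> B"
  shows "hit_prob B z y = (\<Sum>w\<in>S. K z w * hit_prob B w y)"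
proof -
  have eq: "(\<exists>t. case_nat z \<omega> t = y \<and> (\<forall>s<t. case_nat z \<omega> s \<notin> B)) \<longleftrightarrow> (\<exists>t. \<omega> t = y \<and> (\<forall>s<t. \<omega> s \<notin> B))"
    (is "?L \<longleftrightarrow> ?R") for \<omega>
  proof
    assume ?L
    then obtain t where t: "case_nat z \<omega> t = y" "\<forall>s<t. case_nat z \<omega> s \<notin> B" by blast
    then have "t \<noteq> 0" using assms by (intro notI) simp
    then obtain u where u: "t = Suc u" using not0_implies_Suc by blast
    have "\<omega> u = y" using t(1) u by simp
    moreover have "\<forall>s<u. \<omega> s \<notin> B"
      using t(2) unfolding u all_less_Suc_case_nat[of u "\<lambda>x. x \<notin> B"] by (rule conjunct2)
    ultimately show ?R by blast
  next
    assume ?R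
    then obtain u where "\<omega> u = y" "\<forall>s<u. \<omega> s \<notin> B" by blast
    then have "case_nat z \<omega> (Suc u) = y \<and> (\<forall>s<Suc u. case_nat z \<omega> s \<notin> B)"
      using assms(2) all_less_Suc_case_nat[of u "\<lambda>x. x \<notin> B"] by simp
    then show ?L by blast
  qed
  have "Measurable.pred path_space (\<lambda>\<omega>. \<exists>t. \<omega> t = y \<and> (\<forall>s<t. \<omega> s \<notin> B))" by measurable
  from prob_first_step[OF assms(1) this] show ?thesis
    unfolding hit_prob_def eq .
qed

text \<open>A return to \<open>B\<close> is one free step followed by entering \<open>B\<close>,
  where the state reached by that step may already be the entrance point. This reduces all
  properties of the trace kernel to harmonicity of \<open>hit_prob\<close>.\<close>

lemma trace_kernel_eq:
  assumes "z \<in> S" "y \<in> B"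
  shows "trace_kernel S K B z y = (\<Sum>w\<in>S. K z w * hit_prob B w y)"
proof -
  \<comment> \<open>Replacing the least return time by an existential statement about shifted
    coordinates gives an event to which \<open>prob_first_step\<close> applies and whose shifted
    form is the one in \<open>hit_prob\<close>.\<close>
  have trace: "(\<exists>t\<ge>1. \<omega> t \<in> B) \<and> \<omega> (LEAST t. 1 \<le> t \<and> \<omega> t \<in> B) = y
    \<longleftrightarrow> (\<exists>t. \<omega> (Suc t) = y \<and> (\<forall>s<t. \<omega> (Suc s) \<notin> B))" (is "?L \<longleftrightarrow> ?R") for \<omega> :: "nat \<Rightarrow> 'a"
  proof
    assume L: ?L
    let ?l = "LEAST t. 1 \<le> t \<and> \<omega> t \<in> B"
    have l: "1 \<le> ?l \<and> \<omega> ?l \<in> B"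
      by (rule LeastI_ex[of "\<lambda>t. 1 \<le> t \<and> \<omega> t \<in> B"]) (use L in blast)
    then have "?l \<noteq> 0" by linarith
    then obtain t where t: "?l = Suc t" using not0_implies_Suc by blast
    have "\<omega> (Suc s) \<notin> B" if "s < t" for s
    proof -
      have "Suc s < ?l" using that unfolding t by simp
      from not_less_Least[OF this] show ?thesis by simp
    qed
    moreover have "\<omega> (Suc t) = y" using conjunct2[OF L] unfolding t .
    ultimately show ?R by blast
  next
    assume ?R
    then obtain t where t: "\<omega> (Suc t) = y" "\<forall>s<t. \<omega> (Suc s) \<notin> B" by blast
    have "(LEAST t. 1 \<le> t \<and> \<omega> t \<in> B) = Suc t"
    proof (rule Least_equality)
      show "1 \<le> Suc t \<and> \<omega> (Suc t) \<in> B" using t assms(2) by simp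
      fix u assume u: "1 \<le> u \<and> \<omega> u \<in> B"
      then obtain s where s: "u = Suc s" by (cases u) auto
      then have "\<not> s < t" using u t(2) by blast
      then show "Suc t \<le> u" using s by simp
    qed
    moreover have "\<exists>t\<ge>1. \<omega> t \<in> B" using t assms(2) by (intro exI[of _ "Suc t"]) simp
    ultimately show ?L using t by simp
  qed
  have "Measurable.pred path_space (\<lambda>\<omega>. \<exists>t. \<omega> (Suc t) = y \<and> (\<forall>s<t. \<omega> (Suc s) \<notin> B))" by measurable
  from prob_first_step[OF assms(1) this] show ?thesis
    unfolding trace_kernel_def hit_prob_def trace by (simp only: nat.case)
qed

text \<open>The total mass is harmonic off \<open>B\<close> and equal to 1 on \<open>B\<close>; the
  minimum principle for it and for its negative pins it to 1 everywhere.\<close>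

lemma sum_hit_prob:
  assumes B: "B \<subseteq> S" "B \<noteq> {}" and "z \<in> S"
  shows "(\<Sum>y\<in>B. hit_prob B z y) = 1"
proof -
  let ?u = "\<lambda>z. \<Sum>y\<in>B. hit_prob B z y"
  have fB: "finite B" using B finite_S by (simp add: finite_subset)
  have harm: "(\<Sum>w\<in>S. K x w * ?u w) = ?u x" if "x \<in> S - B" for x
  proof -
    have "?u x = (\<Sum>y\<in>B. \<Sum>w\<in>S. K x w * hit_prob B w y)"
      using that by (intro sum.cong refl hit_prob_notin) auto
    also have "\<dots> = (\<Sum>w\<in>S. K x w * ?u w)"
      unfolding sum_distrib_left by (rule sum.swap)
    finally show ?thesis by simp
  qed
  have one: "?u x = 1" if "x \<in> B" for x
  proof -
    have "?u x = (\<Sum>y\<in>B. of_bool (x = y))"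
      using that B by (intro sum.cong refl hit_prob_in) auto
    also have "\<dots> = 1" using that fB by (simp add: of_bool_def)
    finally show ?thesis .
  qed
  have "1 \<le> ?u z"
    by (rule minimum_principle[OF B _ _ \<open>z \<in> S\<close>, where f="?u"]) (simp_all only: harm one order.refl)
  moreover have "- 1 \<le> - ?u z"
    by (rule minimum_principle[OF B _ _ \<open>z \<in> S\<close>, where f="\<lambda>x. - ?u x"])
      (simp_all only: mult_minus_right sum_negf harm one order.refl)
  ultimately show ?thesis by simp
qed

section \<open>Stochasticity, irreducibility and reversibility of the trace\<close>

lemma trace_kernel_nonneg: "0 \<le> trace_kernel S K B x y"
  by (simp add: trace_kernel_def)

lemma stochastic_trace_kernel:
  assumes B: "B \<subseteq> S" "B \<noteq> {}"
  shows "stochastic_on B (trace_kernel S K B)"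
proof -
  have "(\<Sum>y\<in>B. trace_kernel S K B x y) = 1" if "x \<in> B" for x
  proof -
    have x: "x \<in> S" using that B by blast
    have "(\<Sum>y\<in>B. trace_kernel S K B x y) = (\<Sum>y\<in>B. \<Sum>w\<in>S. K x w * hit_prob B w y)"
      using x by (intro sum.cong refl trace_kernel_eq)
    also have "\<dots> = (\<Sum>w\<in>S. K x w * (\<Sum>y\<in>B. hit_prob B w y))"
      unfolding sum_distrib_left by (rule sum.swap)
    also have "\<dots> = (\<Sum>w\<in>S. K x w)"
      using sum_hit_prob[OF B] by simp
    finally show ?thesis using K_sum[OF x] by simp
  qed
  then show ?thesis by (simp add: stochastic_on_def trace_kernel_nonneg)
qed

lemma finite_chain_trace_kernel:
  assumes "B \<subseteq> S" "B \<noteq> {}"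
  shows "finite_chain B (trace_kernel S K B)"
  using finite_subset[OF assms(1) finite_S] stochastic_trace_kernel[OF assms] by (rule finite_chain.intro)

lemma K_hit_prob_le:
  assumes "x \<in> S" "w \<in> S"
  shows "K x w * hit_prob B w y \<le> (\<Sum>v\<in>S. K x v * hit_prob B v y)"
  by (rule member_le_sum[where f="\<lambda>v. K x v * hit_prob B v y", OF assms(2) _ finite_S])
    (simp add: K_nonneg assms(1))

text \<open>A direct transition inside \<open>B\<close> is a return of length one. On the diagonal
  this gives laziness of the trace.\<close>

lemma K_le_trace_kernel:
  assumes "B \<subseteq> S" "x \<in> B" "y \<in> B"
  shows "K x y \<le> trace_kernel S K B x y"
proof -
  have xy: "x \<in> S" "y \<in> S" using assms by auto
  have "K x y = K x y * hit_prob B y y" using assms xy by (simp add: hit_prob_in)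
  also have "\<dots> \<le> trace_kernel S K B x y"
    unfolding trace_kernel_eq[OF xy(1) assms(3)] by (rule K_hit_prob_le[OF xy])
  finally show ?thesis .
qed

lemma irreducible_trace_kernel:
  assumes B: "B \<subseteq> S" "B \<noteq> {}"
  shows "irreducible_on B (trace_kernel S K B)"
proof -
  let ?T = "trace_kernel S K B"
  interpret Tr: finite_chain B ?T using B by (rule finite_chain_trace_kernel)
  \<comment> \<open>Starting points outside \<open>B\<close> must be allowed, since a path between
    points of \<open>B\<close> may leave it. The claim records an entrance point \<open>v\<close>
    from which the trace chain reaches \<open>y\<close>; stepping back along the path keeps
    \<open>v\<close> outside \<open>B\<close> and adds one trace step inside.\<close>
  have main: "\<exists>n. \<exists>v\<in>B. 0 < hit_prob B w v \<and> 0 < \<P>(\<omega> in path_law B ?T v. \<omega> n \<in> {y})"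
    if "y \<in> B" "w \<in> S" "0 < \<P>(\<omega> in path_law S K w. \<omega> t \<in> {y})" for t w y
    using that(2,3)
  proof (induction t arbitrary: w)
    case 0
    have "\<P>(\<omega> in path_law S K w. \<omega> 0 \<in> {y}) = of_bool (w \<in> {y})"
      by (rule prob_coordinate_0[OF 0(1)])
    with 0 have "w = y" by (auto split: if_splits)
    then have "0 < hit_prob B w y" using \<open>y \<in> B\<close> 0(1) by (simp add: hit_prob_in)
    moreover have "0 < \<P>(\<omega> in path_law B ?T y. \<omega> 0 \<in> {y})"
      unfolding Tr.prob_coordinate_0[OF \<open>y \<in> B\<close>] by simp
    ultimately show ?case using \<open>y \<in> B\<close> by blast
  next
    case (Suc t)
    have "0 < (\<Sum>u\<in>S. K w u * \<P>(\<omega> in path_law S K u. \<omega> t \<in> {y}))"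
      using Suc.prems(2) unfolding prob_coordinate_Suc[OF Suc.prems(1)] .
    then obtain u where u: "u \<in> S" "K w u * \<P>(\<omega> in path_law S K u. \<omega> t \<in> {y}) > 0"
      by (meson not_le sum_nonpos)
    then have Ku: "K w u > 0" and pu: "\<P>(\<omega> in path_law S K u. \<omega> t \<in> {y}) > 0"
      using K_nonneg[OF Suc.prems(1) u(1)] by (auto simp: zero_less_mult_iff)
    obtain n v where v: "v \<in> B" "0 < hit_prob B u v" "0 < \<P>(\<omega> in path_law B ?T v. \<omega> n \<in> {y})"
      using Suc.IH[OF u(1) pu] by blast
    have "0 < K w u * hit_prob B u v" using Ku v by simp
    then have sum_pos: "0 < (\<Sum>u\<in>S. K w u * hit_prob B u v)"
      using K_hit_prob_le[OF Suc.prems(1) u(1)] by (rule less_le_trans)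
    show ?case
    proof (cases "w \<in> B")
      case False
      then have "0 < hit_prob B w v"
        using hit_prob_notin[OF Suc.prems(1) False v(1)] sum_pos by (simp only:)
      then show ?thesis using v by blast
    next
      case True
      have "0 < ?T w v" unfolding trace_kernel_eq[OF Suc.prems(1) v(1)] by (rule sum_pos)
      then have "0 < ?T w v * \<P>(\<omega> in path_law B ?T v. \<omega> n \<in> {y})" using v(3) by simp
      also have "\<dots> \<le> (\<Sum>v\<in>B. ?T w v * \<P>(\<omega> in path_law B ?T v. \<omega> n \<in> {y}))"
        by (rule member_le_sum[where f="\<lambda>v. ?T w v * \<P>(\<omega> in path_law B ?T v. \<omega> n \<in> {y})", OF v(1) _ Tr.finite_S])
          (intro mult_nonneg_nonneg trace_kernel_nonneg measure_nonneg)
      also have "\<dots> = \<P>(\<omega> in path_law B ?T w. \<omega> (Suc n) \<in> {y})"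
        by (rule Tr.prob_coordinate_Suc[OF True, symmetric])
      finally have "0 < \<P>(\<omega> in path_law B ?T w. \<omega> (Suc n) \<in> {y})" .
      moreover have "0 < hit_prob B w w" using hit_prob_in[OF Suc.prems(1) True True] by simp
      ultimately show ?thesis using True by blast
    qed
  qed
  have "\<exists>t. 0 < \<P>(\<omega> in path_law B ?T x. \<omega> t = y)" if "x \<in> B" "y \<in> B" for x y
  proof -
    have x: "x \<in> S" "y \<in> S" using that B by auto
    obtain t where "0 < \<P>(\<omega> in path_law S K x. \<omega> t \<in> {y})"
      using irreducible x by (auto simp: irreducible_on_def)
    from main[OF that(2) x(1) this] obtain n v
      where v: "v \<in> B" "0 < hit_prob B x v" "0 < \<P>(\<omega> in path_law B ?T v. \<omega> n \<in> {y})" by blast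
    \<comment> \<open>A path starting in \<open>B\<close> has its own starting point as entrance
      point.\<close>
    have "v = x" using v(2) unfolding hit_prob_in[OF x(1) that(1) v(1)] by (simp split: if_splits)
    then show ?thesis using v(3) by auto
  qed
  then show ?thesis by (simp add: irreducible_on_def)
qed

text \<open>
  Green's identity for \<open>u = hit_prob B \<cdot> x\<close> and \<open>v = hit_prob B \<cdot> y\<close>, which are harmonic off \<open>B\<close>: the
  defect \<open>v - K v\<close> is supported on \<open>B\<close>, where it is \<open>\<lambda>w. of_bool (w = y) - trace_kernel S K B w y\<close>.
\<close>

lemma reversible_trace_kernel:
  assumes B: "B \<subseteq> S" and xy: "x \<in> B" "y \<in> B"
    and rev: "\<And>x y. x \<in> S \<Longrightarrow> y \<in> S \<Longrightarrow> \<pi> x * K x y = \<pi> y * K y x"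
  shows "\<pi> x * trace_kernel S K B x y = \<pi> y * trace_kernel S K B y x"
proof -
  define E where "E u v = (\<Sum>w\<in>S. \<pi> w * u w * (v w - (\<Sum>z\<in>S. K w z * v z)))" for u v
  have sym: "E u v = E v u" for u v
  proof -
    have E: "E u v = (\<Sum>w\<in>S. \<pi> w * u w * v w) - (\<Sum>w\<in>S. \<Sum>z\<in>S. (\<pi> w * K w z) * (u w * v z))" for u v
      by (simp add: E_def right_diff_distrib sum_subtractf sum_distrib_left mult_ac)
    have "(\<Sum>w\<in>S. \<Sum>z\<in>S. (\<pi> w * K w z) * (u w * v z)) = (\<Sum>w\<in>S. \<Sum>z\<in>S. (\<pi> z * K z w) * (v z * u w))"
      by (intro sum.cong refl) (simp add: rev mult.commute)
    also have "\<dots> = (\<Sum>w\<in>S. \<Sum>z\<in>S. (\<pi> w * K w z) * (v w * u z))"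
      by (rule sum.swap)
    finally show ?thesis unfolding E by (simp add: mult_ac)
  qed
  have green: "E (\<lambda>w. hit_prob B w x) (\<lambda>w. hit_prob B w y) = \<pi> x * (of_bool (x = y) - trace_kernel S K B x y)"
    if xy: "x \<in> B" "y \<in> B" for x y
  proof -
    have "E (\<lambda>w. hit_prob B w x) (\<lambda>w. hit_prob B w y)
      = (\<Sum>w\<in>S. if w = x then \<pi> x * (of_bool (x = y) - trace_kernel S K B x y) else 0)"
      unfolding E_def
    proof (rule sum.cong)
      fix w assume w: "w \<in> S"
      show "\<pi> w * hit_prob B w x * (hit_prob B w y - (\<Sum>z\<in>S. K w z * hit_prob B z y))
        = (if w = x then \<pi> x * (of_bool (x = y) - trace_kernel S K B x y) else 0)"
      proof (cases "w \<in> B")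
        case True
        then show ?thesis
          unfolding trace_kernel_eq[OF w xy(2), symmetric] using w xy by (simp add: hit_prob_in)
      next
        case False
        then have "w \<noteq> x" using xy by blast
        then show ?thesis using hit_prob_notin[OF w False xy(2)] by simp
      qed
    qed simp
    also have "\<dots> = \<pi> x * (of_bool (x = y) - trace_kernel S K B x y)"
      using finite_S xy B by (auto simp: sum.delta)
    finally show ?thesis .
  qed
  show ?thesis
    using sym[of "\<lambda>w. hit_prob B w x" "\<lambda>w. hit_prob B w y"] green[OF xy] green[OF xy(2,1)]
    by (cases "x = y") simp_all
qed

text \<open>If \<open>B\<close> is visited at least t times and \<open>A\<close> is missed
  throughout, then the trace chain, started from the entrance point of the path in \<open>B\<close>,
  misses \<open>A\<close> at its first t instants. Instead of extracting the trace path, the proof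
  checks that the right-hand side obeys the matching first-step recursion: harmonic off
  \<open>B\<close>, and on \<open>B\<close> a trace step that lowers t by one. It is only an
  inequality, as the left side also forbids hits of \<open>A\<close> outside
  \<open>B\<close>.\<close>

lemma visits_and_miss_le:
  assumes B: "B \<subseteq> S" "B \<noteq> {}" and z: "z \<in> S"
  shows "\<P>(\<omega> in path_law S K z. t \<le> visits B N \<omega> \<and> (\<forall>u<N. \<omega> u \<notin> A))
    \<le> (\<Sum>y\<in>B. hit_prob B z y * finite_chain.miss_prob B (trace_kernel S K B) A t y)"
  using z
proof (induction N arbitrary: t z)
  interpret Tr: finite_chain B "trace_kernel S K B" using B by (rule finite_chain_trace_kernel)
  let ?h = "\<lambda>t z. \<Sum>y\<in>B. hit_prob B z y * Tr.miss_prob A t y"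
  have t0: "?h 0 z = 1" if "z \<in> S" for z
    using sum_hit_prob[OF B that] by (simp add: Tr.miss_prob_0)
  have h_nonneg: "0 \<le> ?h t z" for t z by (intro sum_nonneg mult_nonneg_nonneg) simp_all
  {
    case 0
    show ?case
    proof (cases t)
      case 0
      then show ?thesis using t0[OF \<open>z \<in> S\<close>] by (simp add: \<open>z \<in> S\<close>)
    next
      case (Suc s)
      then show ?thesis using h_nonneg[of z "Suc s"] by simp
    qed
  next
    case (Suc N)
    let ?Q = "\<lambda>t \<omega>. t \<le> visits B N \<omega> \<and> (\<forall>u<N. \<omega> u \<notin> A)"
    have "Measurable.pred path_space (\<lambda>\<omega>. t \<le> visits B (Suc N) \<omega> \<and> (\<forall>u<Suc N. \<omega> u \<notin> A))" by measurable
    from prob_first_step[OF \<open>z \<in> S\<close> this]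
    have step: "\<P>(\<omega> in path_law S K z. t \<le> visits B (Suc N) \<omega> \<and> (\<forall>u<Suc N. \<omega> u \<notin> A))
      = (\<Sum>w\<in>S. K z w * \<P>(\<omega> in path_law S K w. t \<le> of_bool (z \<in> B) + visits B N \<omega> \<and> z \<notin> A \<and> (\<forall>u<N. \<omega> u \<notin> A)))"
      unfolding visits_Suc_case_nat all_less_Suc_case_nat[of N "\<lambda>x. x \<notin> A"] .
    have IH: "(\<Sum>w\<in>S. K z w * \<P>(\<omega> in path_law S K w. ?Q s \<omega>)) \<le> (\<Sum>y\<in>B. (\<Sum>w\<in>S. K z w * hit_prob B w y) * Tr.miss_prob A s y)"
      for s
    proof -
      have "(\<Sum>w\<in>S. K z w * \<P>(\<omega> in path_law S K w. ?Q s \<omega>)) \<le> (\<Sum>w\<in>S. K z w * ?h s w)"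
        using Suc.IH K_nonneg[OF \<open>z \<in> S\<close>] by (intro sum_mono mult_left_mono) simp_all
      also have "\<dots> = (\<Sum>y\<in>B. (\<Sum>w\<in>S. K z w * hit_prob B w y) * Tr.miss_prob A s y)"
        unfolding sum_distrib_left sum_distrib_right mult.assoc[symmetric] by (rule sum.swap)
      finally show ?thesis .
    qed
    \<comment> \<open>For \<open>t = 0\<close> the right side is 1, and for z in \<open>A\<close>
      the left side is 0. Otherwise a first step is taken, and it uses up a visit only if z lies in
      \<open>B\<close>.\<close>
    consider "t = 0" | "z \<in> A" | "z \<notin> A" "z \<notin> B" | s where "t = Suc s" "z \<notin> A" "z \<in> B"
      using not0_implies_Suc by blast
    then show ?case
    proof cases
      case 1
      then show ?thesis
        using t0[OF \<open>z \<in> S\<close>] prob_space.prob_le_1[OF prob_space_path_law[OF \<open>z \<in> S\<close>]] by simp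
    next
      case 2
      then show ?thesis unfolding step using h_nonneg by simp
    next
      case 3
      have "\<P>(\<omega> in path_law S K z. t \<le> visits B (Suc N) \<omega> \<and> (\<forall>u<Suc N. \<omega> u \<notin> A))
        = (\<Sum>w\<in>S. K z w * \<P>(\<omega> in path_law S K w. ?Q t \<omega>))"
        unfolding step using 3 by simp
      also note IH
      also have "(\<Sum>y\<in>B. (\<Sum>w\<in>S. K z w * hit_prob B w y) * Tr.miss_prob A t y) = ?h t z"
        using hit_prob_notin[OF \<open>z \<in> S\<close> 3(2)] by simp
      finally show ?thesis .
    next
      case 4
      have "\<P>(\<omega> in path_law S K z. t \<le> visits B (Suc N) \<omega> \<and> (\<forall>u<Suc N. \<omega> u \<notin> A))
        = (\<Sum>w\<in>S. K z w * \<P>(\<omega> in path_law S K w. ?Q s \<omega>))"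
        unfolding step using 4 by simp
      also note IH
      also have "(\<Sum>y\<in>B. (\<Sum>w\<in>S. K z w * hit_prob B w y) * Tr.miss_prob A s y)
        = (\<Sum>y\<in>B. trace_kernel S K B z y * Tr.miss_prob A s y)"
        using trace_kernel_eq[OF \<open>z \<in> S\<close>] by simp
      also have "\<dots> = Tr.miss_prob A t z"
        using 4 by (simp add: Tr.miss_prob_Suc)
      also have "\<dots> = (\<Sum>y\<in>B. if y = z then Tr.miss_prob A t z else 0)"
        using 4 Tr.finite_S by simp
      also have "\<dots> = ?h t z"
        using 4 \<open>z \<in> S\<close> by (intro sum.cong refl) (auto simp: hit_prob_in)
      finally show ?thesis .
    qed
  }
qed

text \<open>Split according to whether \<open>B\<close> is visited at least t times; in that case
  the entrance law has total mass 1, so averaging the uniform bound \<open>M\<close> under it leaves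
  \<open>M\<close>.\<close>

lemma miss_prob_le_visits:
  assumes B: "B \<subseteq> S" "B \<noteq> {}" and z: "z \<in> S"
    and M: "\<And>y. y \<in> B \<Longrightarrow> finite_chain.miss_prob B (trace_kernel S K B) A t y \<le> M"
  shows "miss_prob A N z \<le> \<P>(\<omega> in path_law S K z. visits B N \<omega> < t) + M"
proof -
  interpret P: prob_space "path_law S K z" by (rule prob_space_path_law[OF z])
  have events: "{\<omega> \<in> space (path_law S K z). Q \<omega>} \<in> P.events" if "Measurable.pred path_space Q" for Q
    using that z by (simp only: pred_def sets_path_law space_path_law space_path_space)
  let ?V = "{\<omega> \<in> space (path_law S K z). visits B N \<omega> < t}"
  let ?W = "{\<omega> \<in> space (path_law S K z). t \<le> visits B N \<omega> \<and> (\<forall>u<N. \<omega> u \<notin> A)}"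
  have V: "?V \<in> P.events" by (rule events) measurable
  have W: "?W \<in> P.events" by (rule events) measurable
  have "miss_prob A N z \<le> P.prob (?V \<union> ?W)"
    unfolding miss_prob_def by (intro P.finite_measure_mono sets.Un V W) auto
  also have "\<dots> \<le> P.prob ?V + P.prob ?W"
    by (rule measure_Un_le[OF V W])
  also have "P.prob ?W \<le> (\<Sum>y\<in>B. hit_prob B z y * finite_chain.miss_prob B (trace_kernel S K B) A t y)"
    by (rule visits_and_miss_le[OF B z])
  also have "\<dots> \<le> (\<Sum>y\<in>B. hit_prob B z y * M)"
    using M by (intro sum_mono mult_left_mono) simp_all
  also have "\<dots> = M" unfolding sum_distrib_right[symmetric] sum_hit_prob[OF B z] by simp
  finally show ?thesis by simp
qed

end

lemma lazy_reversible_chainD: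
  assumes "lazy_reversible_chain S K \<pi>"
  shows "irreducible_chain S K" "is_stationary S K \<pi>" "2 \<le> card S"
    "\<And>x y. x \<in> S \<Longrightarrow> y \<in> S \<Longrightarrow> \<pi> x * K x y = \<pi> y * K y x"
    "\<And>x. x \<in> S \<Longrightarrow> 1/2 \<le> K x x"
  using assms
  by (auto simp: lazy_reversible_chain_def irreducible_chain_def finite_chain_def irreducible_chain_axioms_def)

lemma stationary_dist_eq:
  assumes "lazy_reversible_chain S K \<pi>"
  shows "stationary_dist S K = \<pi>"
proof -
  note D = lazy_reversible_chainD[OF assms]
  interpret irreducible_chain S K by (rule D)
  show ?thesis
    unfolding stationary_dist_def
    by (rule the_equality[where P="is_stationary S K", OF D(2)]) (rule reversible_stationary_unique[OF D(2) _ D(4)])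
qed

text \<open>The stationary law of the trace is \<pi> conditioned on \<open>B\<close>; the common
  normalising factor leaves detailed balance intact.\<close>

lemma lazy_reversible_trace_kernel:
  assumes chain: "lazy_reversible_chain S K \<pi>" and B: "B \<subseteq> S" "2 \<le> card B"
  shows "lazy_reversible_chain B (trace_kernel S K B) (\<lambda>x. if x \<in> B then \<pi> x / sum \<pi> B else 0)"
proof -
  note D = lazy_reversible_chainD[OF chain]
  interpret irreducible_chain S K by (rule D)
  let ?T = "trace_kernel S K B" and ?\<pi> = "\<lambda>x. if x \<in> B then \<pi> x / sum \<pi> B else 0"
  have ne: "B \<noteq> {}" and fB: "finite B" using B finite_subset[OF B(1) finite_S] by auto
  have pos: "0 < sum \<pi> B"
    using B ne fB stationary_pos[OF D(2)] by (intro sum_pos) auto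
  have stoch: "stochastic_on B ?T" by (rule stochastic_trace_kernel[OF B(1) ne])
  have rev: "?\<pi> x * ?T x y = ?\<pi> y * ?T y x" if "x \<in> B" "y \<in> B" for x y
    using reversible_trace_kernel[OF B(1) that D(4)] that by simp
  have "is_stationary B ?T ?\<pi>"
    unfolding is_stationary_def
  proof (intro conjI ballI allI impI)
    fix x assume "x \<in> B"
    then show "0 \<le> ?\<pi> x"
      using stationary_pos[OF D(2)] B pos by (auto intro!: divide_nonneg_pos less_imp_le)
  next
    have "(\<Sum>x\<in>B. ?\<pi> x) = (\<Sum>x\<in>B. \<pi> x) / sum \<pi> B"
      unfolding sum_divide_distrib by (intro sum.cong refl) simp
    then show "(\<Sum>x\<in>B. ?\<pi> x) = 1" using pos by simp
  next
    fix y assume y: "y \<in> B"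
    \<comment> \<open>Detailed balance turns the incoming flow at y into the outgoing flow, and a
      row of the trace kernel sums to 1.\<close>
    have "(\<Sum>x\<in>B. ?\<pi> x * ?T x y) = (\<Sum>x\<in>B. ?\<pi> y * ?T y x)"
      by (rule sum.cong[OF refl rev[OF _ y]])
    also have "\<dots> = ?\<pi> y * (\<Sum>x\<in>B. ?T y x)" by (rule sum_distrib_left[symmetric])
    also have "(\<Sum>x\<in>B. ?T y x) = 1" using stoch y by (simp add: stochastic_on_def)
    finally show "(\<Sum>x\<in>B. ?\<pi> x * ?T x y) = ?\<pi> y" by (simp only: mult_1_right)
  qed simp
  moreover have "1/2 \<le> ?T x x" if "x \<in> B" for x
    using K_le_trace_kernel[OF B(1) that that] D(5)[of x] B(1) that by auto
  ultimately show ?thesis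
    unfolding lazy_reversible_chain_def
    using fB B(2) stoch irreducible_trace_kernel[OF B(1) ne] rev by blast
qed

subsection \<open>Relabelling the states\<close>

text \<open>Path laws need not be transported as measures: mixing times depend only on marginals at
  fixed times, expected hitting times only on miss probabilities, and both families are determined
  by first-step recursions that relabelling preserves.\<close>

locale relabelled_chain = finite_chain S K
  for S :: "'a set" and K +
  fixes f :: "'a \<Rightarrow> 'b" and K' :: "'b \<Rightarrow> 'b \<Rightarrow> real"
  assumes inj: "inj_on f S"
    and K': "\<And>x y. x \<in> S \<Longrightarrow> y \<in> S \<Longrightarrow> K' (f x) (f y) = K x y"
begin

lemma sum_image: "(\<Sum>y\<in>f ` S. g y) = (\<Sum>x\<in>S. g (f x))"
  by (simp add: sum.reindex[OF inj])

lemma finite_chain_image: "finite_chain (f ` S) K'"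
proof
  show "stochastic_on (f ` S) K'"
    using stochastic unfolding stochastic_on_def sum_image by (simp add: K')
qed (simp add: finite_S)

interpretation R: finite_chain "f ` S" K'
  by (rule finite_chain_image)

lemma image_mem_iff: "A \<subseteq> S \<Longrightarrow> x \<in> S \<Longrightarrow> f x \<in> f ` A \<longleftrightarrow> x \<in> A"
  using inj by (simp add: inj_on_image_mem_iff)

lemma prob_coordinate_image:
  assumes "A \<subseteq> S" "x \<in> S"
  shows "\<P>(\<omega> in path_law (f ` S) K' (f x). \<omega> t \<in> f ` A) = \<P>(\<omega> in path_law S K x. \<omega> t \<in> A)"
  using assms(2)
proof (induction t arbitrary: x)
  case 0
  then have fx: "f x \<in> f ` S" by simp
  show ?case
    unfolding prob_coordinate_0[OF 0] R.prob_coordinate_0[OF fx] image_mem_iff[OF assms(1) 0] ..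
next
  case (Suc t)
  then have fx: "f x \<in> f ` S" by simp
  show ?case
    unfolding prob_coordinate_Suc[OF Suc.prems] R.prob_coordinate_Suc[OF fx] sum_image
    by (intro sum.cong refl) (simp only: K' Suc.prems Suc.IH)
qed

lemma miss_prob_image:
  assumes "A \<subseteq> S" "x \<in> S"
  shows "R.miss_prob (f ` A) N (f x) = miss_prob A N x"
  using assms(2)
proof (induction N arbitrary: x)
  case 0
  then show ?case by (simp add: miss_prob_0 R.miss_prob_0)
next
  case (Suc N)
  then have fx: "f x \<in> f ` S" by simp
  have "(\<Sum>w\<in>S. K' (f x) (f w) * R.miss_prob (f ` A) N (f w)) = (\<Sum>w\<in>S. K x w * miss_prob A N w)"
    by (intro sum.cong refl) (simp only: K' Suc.prems Suc.IH)
  then show ?case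
    unfolding miss_prob_Suc[OF Suc.prems] R.miss_prob_Suc[OF fx] sum_image
      image_mem_iff[OF assms(1) Suc.prems] by simp
qed

definition image_dist :: "('a \<Rightarrow> real) \<Rightarrow> 'b \<Rightarrow> real" where
  "image_dist \<pi> y = (if y \<in> f ` S then \<pi> (inv_into S f y) else 0)"

lemma image_dist_image: "x \<in> S \<Longrightarrow> image_dist \<pi> (f x) = \<pi> x"
  using inj by (simp add: image_dist_def)

lemma image_dist_outside: "y \<notin> f ` S \<Longrightarrow> image_dist \<pi> y = 0"
  by (simp add: image_dist_def)

lemma sum_image_dist: "A \<subseteq> S \<Longrightarrow> (\<Sum>y\<in>f ` A. image_dist \<pi> y) = (\<Sum>x\<in>A. \<pi> x)"
  by (subst sum.reindex[OF inj_on_subset[OF inj]]) (auto intro!: sum.cong image_dist_image)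

lemma lazy_reversible_chain_image:
  assumes "lazy_reversible_chain S K \<pi>"
  shows "lazy_reversible_chain (f ` S) K' (image_dist \<pi>)"
proof -
  have irr: "irreducible_on S K" and st: "is_stationary S K \<pi>"
    using assms by (auto simp: lazy_reversible_chain_def)
  have "irreducible_on (f ` S) K'"
    unfolding irreducible_on_def
  proof (intro ballI)
    fix a b assume "a \<in> f ` S" "b \<in> f ` S"
    then obtain x y where xy: "x \<in> S" "y \<in> S" "a = f x" "b = f y" by blast
    then obtain t where "0 < \<P>(\<omega> in path_law S K x. \<omega> t \<in> {y})"
      using irr by (auto simp: irreducible_on_def)
    then have "0 < \<P>(\<omega> in path_law (f ` S) K' (f x). \<omega> t \<in> f ` {y})"
      using prob_coordinate_image[of "{y}" x t] xy by simp
    then have "0 < \<P>(\<omega> in path_law (f ` S) K' a. \<omega> t = b)" using xy by simp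
    then show "\<exists>t. 0 < \<P>(\<omega> in path_law (f ` S) K' a. \<omega> t = b)" by (rule exI[of _ t])
  qed
  moreover have "is_stationary (f ` S) K' (image_dist \<pi>)"
    using st unfolding is_stationary_def sum_image by (auto simp: image_dist_image K' image_dist_outside)
  ultimately show ?thesis
    using assms R.stochastic card_image[OF inj]
    by (auto simp: lazy_reversible_chain_def image_dist_image K')
qed

text \<open>Subsets of the image carrier are exactly the images of subsets of \<open>S\<close>, with
  the same probabilities. The chain hypothesis identifies \<open>stationary_dist\<close> on both
  sides.\<close>

lemma mixing_time_image:
  assumes "lazy_reversible_chain S K \<pi>"
  shows "mixing_time (f ` S) K' = mixing_time S K"
proof -
  have tv: "tv_dist (f ` S) (\<lambda>A. \<P>(\<omega> in path_law (f ` S) K' (f x). \<omega> t \<in> A)) (\<lambda>A. \<Sum>y\<in>A. image_dist \<pi> y)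
    = tv_dist S (\<lambda>A. \<P>(\<omega> in path_law S K x. \<omega> t \<in> A)) (\<lambda>A. \<Sum>y\<in>A. \<pi> y)" if "x \<in> S" for x t
    unfolding tv_dist_def image_Pow_surj[OF refl, symmetric] image_image
    by (intro arg_cong[where f=Max] image_cong refl)
      (simp only: Pow_iff prob_coordinate_image[OF _ that] sum_image_dist)
  have "(MAX x\<in>f ` S. tv_dist (f ` S) (\<lambda>A. \<P>(\<omega> in path_law (f ` S) K' x. \<omega> t \<in> A)) (\<lambda>A. \<Sum>y\<in>A. image_dist \<pi> y))
    = (MAX x\<in>S. tv_dist S (\<lambda>A. \<P>(\<omega> in path_law S K x. \<omega> t \<in> A)) (\<lambda>A. \<Sum>y\<in>A. \<pi> y))" for t
    unfolding image_image by (rule arg_cong[where f=Max], rule image_cong[OF refl], rule tv)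
  then show ?thesis
    unfolding mixing_time_def stationary_dist_eq[OF assms]
      stationary_dist_eq[OF lazy_reversible_chain_image[OF assms]]
    by (simp only:)
qed

lemma max_expected_hitting_image:
  "max_expected_hitting (f ` S) K' (image_dist \<pi>) \<alpha> = max_expected_hitting S K \<pi> \<alpha>"
proof -
  let ?P = "{A. A \<subseteq> S \<and> \<alpha> \<le> (\<Sum>x\<in>A. \<pi> x)}"
  let ?E = "\<lambda>z A. \<integral>\<^sup>+\<omega>. ennreal_of_enat (hitting_time A \<omega>) \<partial>path_law S K z"
  let ?E' = "\<lambda>z A. \<integral>\<^sup>+\<omega>. ennreal_of_enat (hitting_time A \<omega>) \<partial>path_law (f ` S) K' z"
  have sets: "{A. A \<subseteq> f ` S \<and> \<alpha> \<le> (\<Sum>x\<in>A. image_dist \<pi> x)} = (\<lambda>A. f ` A) ` ?P"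
  proof (intro equalityI subsetI)
    fix A assume A: "A \<in> {A. A \<subseteq> f ` S \<and> \<alpha> \<le> (\<Sum>x\<in>A. image_dist \<pi> x)}"
    then obtain A0 where "A0 \<subseteq> S" "A = f ` A0" by (auto simp: subset_image_iff)
    with A show "A \<in> (\<lambda>A. f ` A) ` ?P" by (auto simp: sum_image_dist)
  qed (auto simp: sum_image_dist)
  have eq: "?E' (f z) (f ` A) = ?E z A" if "z \<in> S" "A \<subseteq> S" for z A
    using that by (simp only: expected_hitting_time R.expected_hitting_time imageI miss_prob_image)
  have "(\<lambda>(z, A). ?E' z A) ` (f ` S \<times> (\<lambda>A. f ` A) ` ?P) = (\<lambda>(z, A). ?E z A) ` (S \<times> ?P)"
  proof -
    have prod: "f ` S \<times> (\<lambda>A. f ` A) ` ?P = (\<lambda>(z, A). (f z, f ` A)) ` (S \<times> ?P)"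
      by (auto simp: image_iff)
    have "(\<lambda>(z, A). ?E' z A) ` (f ` S \<times> (\<lambda>A. f ` A) ` ?P) = (\<lambda>(z, A). ?E' (f z) (f ` A)) ` (S \<times> ?P)"
      unfolding prod image_image by (rule image_cong) auto
    also have "\<dots> = (\<lambda>(z, A). ?E z A) ` (S \<times> ?P)"
      by (rule image_cong[OF refl]) (auto simp: eq)
    finally show ?thesis .
  qed
  then show ?thesis unfolding max_expected_hitting_def sets by simp
qed

end

lemma mixing_hitting_bounds:
  fixes S :: "'a set"
  assumes constants: "mixing_hitting_constants c c'" and \<alpha>: "0 < \<alpha>" "\<alpha> < 1/2"
    and chain: "lazy_reversible_chain S K \<pi>"
  shows "ennreal (c' \<alpha>) * max_expected_hitting S K \<pi> \<alpha> \<le> of_nat (mixing_time S K)"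
    and "of_nat (mixing_time S K) \<le> ennreal (c \<alpha>) * max_expected_hitting S K \<pi> \<alpha>"
proof -
  note D = lazy_reversible_chainD[OF chain]
  interpret irreducible_chain S K by (rule D)
  obtain f :: "'a \<Rightarrow> nat" where f: "inj_on f S"
    using finite_imp_inj_to_nat_seg[OF finite_S] by blast
  \<comment> \<open>An injection into the naturals exists because \<open>S\<close> is finite; the
    kernel is pulled back along its inverse.\<close>
  let ?K = "\<lambda>a b. K (inv_into S f a) (inv_into S f b)"
  interpret relabelled_chain S K f ?K
    by unfold_locales (simp_all add: f)
  have "ennreal (c' \<alpha>) * max_expected_hitting (f ` S) ?K (image_dist \<pi>) \<alpha> \<le> of_nat (mixing_time (f ` S) ?K) \<and>
    of_nat (mixing_time (f ` S) ?K) \<le> ennreal (c \<alpha>) * max_expected_hitting (f ` S) ?K (image_dist \<pi>) \<alpha>"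
    using constants \<alpha> lazy_reversible_chain_image[OF chain] unfolding mixing_hitting_constants_def by blast
  then show "ennreal (c' \<alpha>) * max_expected_hitting S K \<pi> \<alpha> \<le> of_nat (mixing_time S K)"
    and "of_nat (mixing_time S K) \<le> ennreal (c \<alpha>) * max_expected_hitting S K \<pi> \<alpha>"
    unfolding max_expected_hitting_image mixing_time_image[OF chain] by blast+
qed

lemma expected_hitting_le_max:
  assumes "finite S" "z \<in> S" "A \<subseteq> S" "\<alpha> \<le> sum \<pi> A"
  shows "(\<integral>\<^sup>+\<omega>. ennreal_of_enat (hitting_time A \<omega>) \<partial>path_law S K z) \<le> max_expected_hitting S K \<pi> \<alpha>"
  unfolding max_expected_hitting_def
proof (rule Max_ge)
  have "finite {A. A \<subseteq> S \<and> \<alpha> \<le> sum \<pi> A}"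
    using assms(1) by (auto intro: rev_finite_subset[of "Pow S"])
  with assms(1) show "finite ((\<lambda>(z, A). \<integral>\<^sup>+\<omega>. ennreal_of_enat (hitting_time A \<omega>) \<partial>path_law S K z)
      ` (S \<times> {A. A \<subseteq> S \<and> \<alpha> \<le> sum \<pi> A}))"
    by (intro finite_imageI finite_cartesian_product)
  show "(\<integral>\<^sup>+\<omega>. ennreal_of_enat (hitting_time A \<omega>) \<partial>path_law S K z)
      \<in> (\<lambda>(z, A). \<integral>\<^sup>+\<omega>. ennreal_of_enat (hitting_time A \<omega>) \<partial>path_law S K z)
      ` (S \<times> {A. A \<subseteq> S \<and> \<alpha> \<le> sum \<pi> A})"
    by (rule image_eqI[of _ _ "(z, A)"]) (simp_all add: assms)
qed

subsection \<open>From the parts to the whole chain\<close>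

text \<open>Conditioned on \<open>B\<close>, the target has mass at least \<gamma>, so the lower
  bound of the characterization controls the expected hitting time in the trace chain, and Markov's
  inequality controls the miss probability.\<close>

lemma trace_miss_prob_le:
  assumes constants: "mixing_hitting_constants c c'" and \<gamma>: "0 < \<gamma>" "\<gamma> < 1/2"
    and chain: "lazy_reversible_chain S K \<pi>"
    and B: "B \<subseteq> S" "B \<noteq> {}" and A: "\<gamma> * sum \<pi> B \<le> sum \<pi> (A \<inter> B)"
    and t: "0 < t" and y: "y \<in> B"
  shows "finite_chain.miss_prob B (trace_kernel S K B) A t y
    \<le> real (mixing_time B (trace_kernel S K B)) / (c' \<gamma> * real t)"
proof -
  note D = lazy_reversible_chainD[OF chain]
  interpret irreducible_chain S K by (rule D)
  let ?T = "trace_kernel S K B"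
  interpret Tr: finite_chain B ?T by (rule finite_chain_trace_kernel[OF B])
  have c': "0 < c' \<gamma>" using constants \<gamma> by (simp add: mixing_hitting_constants_def)
  have pos: "0 < sum \<pi> B"
    using B Tr.finite_S stationary_pos[OF D(2)] by (intro sum_pos) auto
  show ?thesis
  proof (cases "2 \<le> card B")
    case True
    let ?\<pi> = "\<lambda>x. if x \<in> B then \<pi> x / sum \<pi> B else 0"
    let ?m = "Tr.miss_prob A t y"
    have tr: "lazy_reversible_chain B ?T ?\<pi>"
      by (rule lazy_reversible_trace_kernel[OF chain B(1) True])
    have "sum ?\<pi> (A \<inter> B) = sum \<pi> (A \<inter> B) / sum \<pi> B"
      unfolding sum_divide_distrib by (rule sum.cong) auto
    then have "\<gamma> \<le> sum ?\<pi> (A \<inter> B)" using A pos by (simp add: le_divide_eq)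
    then have "(\<integral>\<^sup>+\<omega>. ennreal_of_enat (hitting_time (A \<inter> B) \<omega>) \<partial>path_law B ?T y)
        \<le> max_expected_hitting B ?T ?\<pi> \<gamma>"
      by (rule expected_hitting_le_max[OF Tr.finite_S y Int_lower2])
    then have "ennreal (real t * ?m) \<le> max_expected_hitting B ?T ?\<pi> \<gamma>"
      by (rule order_trans[OF Tr.miss_prob_le_expected_hitting_time[OF y, of t "A \<inter> B", unfolded Tr.miss_prob_Int[OF y]]])
    then have "ennreal (c' \<gamma>) * ennreal (real t * ?m) \<le> ennreal (c' \<gamma>) * max_expected_hitting B ?T ?\<pi> \<gamma>"
      by (rule mult_left_mono) simp
    also have "\<dots> \<le> of_nat (mixing_time B ?T)"
      by (rule mixing_hitting_bounds(1)[OF constants \<gamma> tr])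
    finally have "c' \<gamma> * (real t * ?m) \<le> real (mixing_time B ?T)"
      using c' by (simp add: ennreal_mult[symmetric] ennreal_of_nat_eq_real_of_nat)
    then show ?thesis using c' t by (simp add: pos_le_divide_eq mult_ac)
  next
    case False
    \<comment> \<open>The characterization says nothing about one-point chains. Here
      \<open>A\<close> meets \<open>B\<close> because \<gamma> times the mass of \<open>B\<close> is
      positive, so the single state lies in \<open>A\<close> and is hit at time 0.\<close>
    have "card B \<noteq> 0" using B Tr.finite_S by simp
    with False have "card B = 1" by linarith
    then have "B = {y}" using y by (auto simp: card_1_singleton_iff)
    moreover have "A \<inter> B \<noteq> {}" using A pos \<gamma> by (auto simp: mult_le_0_iff)
    ultimately have "y \<in> A" by auto
    then have "Tr.miss_prob A t y = 0"
      using t y by (cases t) (simp_all add: Tr.miss_prob_Suc)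
    then show ?thesis using c' by simp
  qed
qed

text \<open>A \<open>LEAST\<close> has the defining property only if some candidate does. One is
  found by making both summands less than 1/8: first t large for the mixing term, then T large, by
  recurrence, for the occupation term.\<close>

lemma partition_timeE:
  assumes chain: "lazy_reversible_chain S K \<pi>" and d: "0 < d"
    and I: "finite I" "I \<noteq> {}" and \<Omega>: "\<And>i. i \<in> I \<Longrightarrow> \<Omega> i \<subseteq> S \<and> \<Omega> i \<noteq> {}"
    and T: "T = partition_time d S K \<Omega> I"
  obtains t where "1 < T" "0 < t"
    "\<forall>i\<in>I. \<forall>z\<in>S.
       real (mixing_time (\<Omega> i) (trace_kernel S K (\<Omega> i))) / (d * real t)
       + \<P>(\<omega> in path_law S K z. occupation_time (\<Omega> i) T \<omega> < t) < 1/4"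
proof -
  note D = lazy_reversible_chainD[OF chain]
  interpret irreducible_chain S K by (rule D)
  have S_ne: "S \<noteq> {}" using D(3) by auto
  let ?\<phi> = "\<lambda>i. real (mixing_time (\<Omega> i) (trace_kernel S K (\<Omega> i)))"
  let ?p = "\<lambda>T t i z. \<P>(\<omega> in path_law S K z. occupation_time (\<Omega> i) T \<omega> < t)"
  define good where "good T t \<longleftrightarrow> (\<forall>i\<in>I. \<forall>z\<in>S. ?\<phi> i / (d * real t) + ?p T t i z < 1/4)" for T t
  \<comment> \<open>All ranges are finite and nonempty (\<open>1 < T\<close> puts 1 into the range
    of t), so the minimum becomes an existential and the maxima become universal
    quantifiers.\<close>
  have good: "(MIN t\<in>{0<..<T}. MAX i\<in>I. ?\<phi> i / (d * real t) + (MAX z\<in>S. ?p T t i z)) < 1/4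
    \<longleftrightarrow> (\<exists>t\<in>{0<..<T}. good T t)" if "1 < T" for T
  proof -
    have max_S: "?\<phi> i / (d * real t) + (MAX z\<in>S. ?p T t i z) < 1/4
      \<longleftrightarrow> (\<forall>z\<in>S. ?\<phi> i / (d * real t) + ?p T t i z < 1/4)" for i t
    proof -
      have "?\<phi> i / (d * real t) + (MAX z\<in>S. ?p T t i z) < 1/4
        \<longleftrightarrow> (MAX z\<in>S. ?p T t i z) < 1/4 - ?\<phi> i / (d * real t)" by linarith
      also have "\<dots> \<longleftrightarrow> (\<forall>z\<in>S. ?p T t i z < 1/4 - ?\<phi> i / (d * real t))"
        using finite_S S_ne by (subst Max_less_iff) simp_all
      also have "\<dots> \<longleftrightarrow> (\<forall>z\<in>S. ?\<phi> i / (d * real t) + ?p T t i z < 1/4)"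
        by (simp only: less_diff_eq add.commute)
      finally show ?thesis .
    qed
    have max_I: "(MAX i\<in>I. g i) < a \<longleftrightarrow> (\<forall>i\<in>I. g i < a)" for g :: "nat \<Rightarrow> real" and a
      using I by (subst Max_less_iff) simp_all
    have "1 \<in> {0<..<T}" using that by simp
    then have "{0<..<T} \<noteq> {}" by blast
    then have min: "(MIN t\<in>{0<..<T}. g t) < a \<longleftrightarrow> (\<exists>t\<in>{0<..<T}. g t < a)" for g :: "nat \<Rightarrow> real" and a
      by (subst Min_less_iff) simp_all
    show ?thesis
      unfolding min max_I max_S good_def ..
  qed
  \<comment> \<open>The sum over \<open>I\<close> is a convenient common upper bound for the
    thresholds \<open>8 * ?\<phi> i / d\<close>; the successor makes the inequality strict and
    \<open>t0\<close> positive.\<close>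
  define t0 where "t0 = Suc (nat \<lceil>\<Sum>i\<in>I. 8 * ?\<phi> i / d\<rceil>)"
  have small: "?\<phi> i / (d * real t0) < 1/8" if "i \<in> I" for i
  proof -
    have "8 * ?\<phi> i / d \<le> (\<Sum>i\<in>I. 8 * ?\<phi> i / d)"
      using I that d by (intro member_le_sum) auto
    also have "\<dots> < real t0" unfolding t0_def by linarith
    finally show ?thesis using d by (simp add: field_simps t0_def)
  qed
  have "\<forall>\<^sub>F N in sequentially. \<forall>i\<in>I. \<forall>z\<in>S. \<P>(\<omega> in path_law S K z. visits (\<Omega> i) N \<omega> < t0) < 1/8"
  proof (intro eventually_ball_finite I(1) finite_S ballI)
    fix i z assume "i \<in> I" "z \<in> S"
    then have "(\<lambda>N. \<P>(\<omega> in path_law S K z. visits (\<Omega> i) N \<omega> < t0)) \<longlonglongrightarrow> 0"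
      using \<Omega>[of i] by (intro few_visits_tendsto_0) simp_all
    then show "\<forall>\<^sub>F N in sequentially. \<P>(\<omega> in path_law S K z. visits (\<Omega> i) N \<omega> < t0) < 1/8"
      by (rule order_tendstoD(2)) simp
  qed
  then obtain N0 where N0: "\<And>N i z. N0 \<le> N \<Longrightarrow> i \<in> I \<Longrightarrow> z \<in> S \<Longrightarrow>
      \<P>(\<omega> in path_law S K z. visits (\<Omega> i) N \<omega> < t0) < 1/8"
    unfolding eventually_sequentially by blast
  \<comment> \<open>Large enough both for \<open>t0 < T0\<close> and for the recurrence bound at
    \<open>Suc T0\<close> instants.\<close>
  define T0 where "T0 = Suc (N0 + t0)"
  have T0: "1 < T0" "t0 \<in> {0<..<T0}" by (simp_all add: T0_def t0_def)
  have "good T0 t0"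
    unfolding good_def
  proof (intro ballI)
    fix i z assume "i \<in> I" "z \<in> S"
    then have "?p T0 t0 i z < 1/8" unfolding occupation_time_eq_visits by (intro N0) (simp_all add: T0_def)
    then show "?\<phi> i / (d * real t0) + ?p T0 t0 i z < 1/4" using small[OF \<open>i \<in> I\<close>] by linarith
  qed
  then have "1 < T0 \<and> (MIN t\<in>{0<..<T0}. MAX i\<in>I. ?\<phi> i / (d * real t) + (MAX z\<in>S. ?p T0 t i z)) < 1/4"
    using good[OF T0(1)] T0 by blast
  from LeastI[where P="\<lambda>T. 1 < T \<and> (MIN t\<in>{0<..<T}. MAX i\<in>I. ?\<phi> i / (d * real t) + (MAX z\<in>S. ?p T t i z)) < 1/4", OF this]
  have T1: "1 < T" and "(MIN t\<in>{0<..<T}. MAX i\<in>I. ?\<phi> i / (d * real t) + (MAX z\<in>S. ?p T t i z)) < 1/4"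
    unfolding T partition_time_def by blast+
  then obtain t where "0 < t" "good T t" using good[OF T1] by auto
  then show ?thesis using that T1 unfolding good_def by blast
qed

text \<open>Averaging over the parts. Let p > \<beta> be the mass of the selected parts. If
  \<open>A\<close> had at most the fraction \<gamma> of each, then \<alpha> would be at most
  \<gamma> p + (1 - p), hence (1 - \<gamma>) \<beta> < 1 - \<alpha>. The bound on \<gamma> says the
  opposite, \<gamma> \<beta> < \<alpha> + \<beta> - 1; this is where it comes from.\<close>

lemma large_partE:
  fixes \<pi> :: "'a \<Rightarrow> real"
  assumes S: "finite S" "\<And>x. x \<in> S \<Longrightarrow> 0 \<le> \<pi> x" "sum \<pi> S = 1"
    and I: "finite I" "disjoint_family_on \<Omega> I" "\<And>i. i \<in> I \<Longrightarrow> \<Omega> i \<subseteq> S"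
    and \<beta>: "0 < \<beta>" "\<beta> < (\<Sum>i\<in>I. sum \<pi> (\<Omega> i))"
    and \<gamma>: "\<gamma> < (\<alpha> + \<beta> - 1) / \<beta>" "\<gamma> < 1"
    and A: "A \<subseteq> S" "\<alpha> \<le> sum \<pi> A"
  obtains i where "i \<in> I" "\<gamma> * sum \<pi> (\<Omega> i) \<le> sum \<pi> (A \<inter> \<Omega> i)"
proof -
  let ?U = "\<Union>i\<in>I. \<Omega> i" and ?p = "\<Sum>i\<in>I. sum \<pi> (\<Omega> i)"
  have U: "?U \<subseteq> S" using I by blast
  have f: "finite A" "finite ?U" "\<And>i. i \<in> I \<Longrightarrow> finite (\<Omega> i)"
    using S(1) A(1) U I(3) by (auto intro: finite_subset)
  have disj: "\<forall>i\<in>I. \<forall>j\<in>I. i \<noteq> j \<longrightarrow> \<Omega> i \<inter> \<Omega> j = {}"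
    using I(2) by (auto simp: disjoint_family_on_def)
  have "\<exists>i\<in>I. \<gamma> * sum \<pi> (\<Omega> i) \<le> sum \<pi> (A \<inter> \<Omega> i)"
  proof (rule ccontr)
    assume "\<not> ?thesis"
    then have less: "sum \<pi> (A \<inter> \<Omega> i) \<le> \<gamma> * sum \<pi> (\<Omega> i)" if "i \<in> I" for i
      using that by (meson le_cases)
    have pU: "sum \<pi> ?U = ?p"
      using disj by (intro sum.UNION_disjoint I(1)) (auto simp: f)
    have "sum \<pi> (A \<inter> ?U) = sum \<pi> (\<Union>i\<in>I. A \<inter> \<Omega> i)" by (intro arg_cong[where f="sum \<pi>"]) auto
    also have "\<dots> = (\<Sum>i\<in>I. sum \<pi> (A \<inter> \<Omega> i))"
      by (rule sum.UNION_disjoint[OF I(1)]) (use disj f in auto)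
    also have "\<dots> \<le> (\<Sum>i\<in>I. \<gamma> * sum \<pi> (\<Omega> i))" by (rule sum_mono[OF less])
    also have "\<dots> = \<gamma> * ?p" by (rule sum_distrib_left[symmetric])
    finally have 1: "sum \<pi> (A \<inter> ?U) \<le> \<gamma> * ?p" .
    have "sum \<pi> (A - ?U) \<le> sum \<pi> (S - ?U)"
      using S A by (intro sum_mono2) auto
    also have "\<dots> = 1 - ?p" using sum_diff[OF S(1) U, of \<pi>] S(3) pU by simp
    finally have 2: "sum \<pi> (A - ?U) \<le> 1 - ?p" .
    have "sum \<pi> A = sum \<pi> (A \<inter> ?U) + sum \<pi> (A - ?U)"
      by (rule sum.Int_Diff[OF f(1)])
    with 1 2 A(2) have "\<alpha> \<le> \<gamma> * ?p + (1 - ?p)" by linarith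
    then have "(1 - \<gamma>) * ?p \<le> 1 - \<alpha>" by (simp add: algebra_simps)
    moreover have "(1 - \<gamma>) * \<beta> < (1 - \<gamma>) * ?p" using \<beta> \<gamma> by (intro mult_strict_left_mono) simp_all
    moreover have "\<gamma> * \<beta> < \<alpha> + \<beta> - 1" using \<gamma>(1) \<beta>(1) by (simp add: less_divide_eq)
    ultimately show False by (simp add: algebra_simps)
  qed
  then show ?thesis using that by blast
qed

theorem lemma2p1:
  fixes S :: "'a set" and K :: "'a \<Rightarrow> 'a \<Rightarrow> real" and \<pi> :: "'a \<Rightarrow> real"
    and \<Omega> :: "nat \<Rightarrow> 'a set" and n :: nat and I :: "nat set"
    and c c' :: "real \<Rightarrow> real" and \<alpha> \<beta> \<gamma> :: real
  assumes constants: "mixing_hitting_constants c c'"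
    and chain: "lazy_reversible_chain S K \<pi>"
    and parts: "(\<Union>i\<in>{1..n}. \<Omega> i) = S" "disjoint_family_on \<Omega> {1..n}" "\<forall>i\<in>{1..n}. \<Omega> i \<noteq> {}"
    and alpha: "0 < \<alpha>" "\<alpha> < 1/2"
    and beta: "1 - \<alpha> < \<beta>" "\<beta> < 1"
    and gamma: "0 < \<gamma>" "\<gamma> < min (1/2) ((\<alpha> + \<beta> - 1) / \<beta>)"
    and I: "I \<subseteq> {1..n}" "(\<Sum>i\<in>I. \<Sum>x\<in>\<Omega> i. \<pi> x) > \<beta>"
  shows "real (mixing_time S K) \<le> 4/3 * c \<alpha> * real (partition_time (c' \<gamma>) S K \<Omega> I)"
proof -
  note D = lazy_reversible_chainD[OF chain]
  interpret irreducible_chain S K by (rule D)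
  define T where "T = partition_time (c' \<gamma>) S K \<Omega> I"
  have c: "0 < c \<alpha>" and c': "0 < c' \<gamma>"
    using constants alpha gamma by (auto simp: mixing_hitting_constants_def)
  have \<beta>0: "0 < \<beta>" using alpha beta by linarith
  have fI: "finite I" using I(1) finite_subset by blast
  \<comment> \<open>The empty sum could not exceed the positive number \<beta>.\<close>
  have neI: "I \<noteq> {}" using I(2) \<beta>0 by auto
  have sub: "\<Omega> i \<subseteq> S \<and> \<Omega> i \<noteq> {}" if "i \<in> I" for i using that I(1) parts by blast
  obtain t where t: "1 < T" "0 < t" and small: "\<forall>i\<in>I. \<forall>z\<in>S.
       real (mixing_time (\<Omega> i) (trace_kernel S K (\<Omega> i))) / (c' \<gamma> * real t)
       + \<P>(\<omega> in path_law S K z. occupation_time (\<Omega> i) T \<omega> < t) < 1/4"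
    by (rule partition_timeE[OF chain c' fI neI sub T_def]) blast
  have hit: "(\<integral>\<^sup>+\<omega>. ennreal_of_enat (hitting_time A \<omega>) \<partial>path_law S K z) \<le> ennreal (4/3 * real T)"
    if z: "z \<in> S" and A: "A \<subseteq> S" "\<alpha> \<le> sum \<pi> A" for z A
  proof -
    have disj: "disjoint_family_on \<Omega> I" using parts(2) I(1) by (auto simp: disjoint_family_on_def)
    have nn: "\<And>x. x \<in> S \<Longrightarrow> 0 \<le> \<pi> x" and one: "sum \<pi> S = 1"
      using D(2) by (auto simp: is_stationary_def)
    obtain i where i: "i \<in> I" "\<gamma> * sum \<pi> (\<Omega> i) \<le> sum \<pi> (A \<inter> \<Omega> i)"
      using large_partE[OF finite_S nn one fI disj _ \<beta>0 I(2) _ _ A, of \<gamma>] sub gamma(2)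
      by auto
    \<comment> \<open>The part \<open>i\<close> depends on \<open>A\<close>, while \<open>t\<close>
      was chosen uniformly over \<open>I\<close>, so the bound of the partition time applies to it.
      Occupation up to time T counts T + 1 instants, which matches the horizon
      \<open>Suc T\<close>.\<close>
    have miss: "miss_prob A (Suc T) x \<le> 1/4" if "x \<in> S" for x
    proof -
      have "miss_prob A (Suc T) x \<le> \<P>(\<omega> in path_law S K x. visits (\<Omega> i) (Suc T) \<omega> < t)
          + real (mixing_time (\<Omega> i) (trace_kernel S K (\<Omega> i))) / (c' \<gamma> * real t)"
        using sub[OF i(1)] gamma
        by (intro miss_prob_le_visits[OF _ _ that] trace_miss_prob_le[OF constants _ _ chain _ _ i(2) t(2)]) auto
      then show ?thesis
        using small[rule_format, OF i(1) that] unfolding occupation_time_eq_visits by linarith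
    qed
    have "0 < T" using t(1) by simp
    \<comment> \<open>With M = 1/4 the geometric bound T / (1 - M) is the factor 4/3 of the
      theorem.\<close>
    from expected_hitting_time_le[OF z this _ miss] show ?thesis by (simp add: mult.commute)
  qed
  have "max_expected_hitting S K \<pi> \<alpha> \<le> ennreal (4/3 * real T)"
    unfolding max_expected_hitting_def
  proof (rule Max.boundedI)
    have "finite {A. A \<subseteq> S \<and> \<alpha> \<le> sum \<pi> A}"
      using finite_S by (auto intro: rev_finite_subset[of "Pow S"])
    with finite_S show "finite ((\<lambda>(z, A). \<integral>\<^sup>+\<omega>. ennreal_of_enat (hitting_time A \<omega>) \<partial>path_law S K z)
        ` (S \<times> {A. A \<subseteq> S \<and> \<alpha> \<le> sum \<pi> A}))"
      by (intro finite_imageI finite_cartesian_product)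
    have "S \<noteq> {}" using D(3) by auto
    \<comment> \<open>The maximum ranges over a nonempty set, since \<open>S\<close> itself has mass
      1 and thus at least \<alpha>.\<close>
    moreover have "S \<in> {A. A \<subseteq> S \<and> \<alpha> \<le> sum \<pi> A}"
      using D(2) alpha by (simp add: is_stationary_def)
    ultimately show "(\<lambda>(z, A). \<integral>\<^sup>+\<omega>. ennreal_of_enat (hitting_time A \<omega>) \<partial>path_law S K z)
        ` (S \<times> {A. A \<subseteq> S \<and> \<alpha> \<le> sum \<pi> A}) \<noteq> {}"
      by blast
  next
    fix e assume "e \<in> (\<lambda>(z, A). \<integral>\<^sup>+\<omega>. ennreal_of_enat (hitting_time A \<omega>) \<partial>path_law S K z)
        ` (S \<times> {A. A \<subseteq> S \<and> \<alpha> \<le> sum \<pi> A})"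
    then show "e \<le> ennreal (4/3 * real T)"
      by (elim imageE SigmaE CollectE conjE) (simp only: split_conv hit)
  qed
  then have "ennreal (c \<alpha>) * max_expected_hitting S K \<pi> \<alpha> \<le> ennreal (c \<alpha>) * ennreal (4/3 * real T)"
    by (rule mult_left_mono) simp
  also have "\<dots> = ennreal (c \<alpha> * (4/3 * real T))"
    using c by (intro ennreal_mult[symmetric]) simp_all
  finally have "of_nat (mixing_time S K) \<le> ennreal (c \<alpha> * (4/3 * real T))"
    by (rule order_trans[OF mixing_hitting_bounds(2)[OF constants alpha chain]])
  then have "ennreal (real (mixing_time S K)) \<le> ennreal (c \<alpha> * (4/3 * real T))"
    by (simp only: ennreal_of_nat_eq_real_of_nat)
  then show ?thesis
    using c unfolding T_def[symmetric] by (subst (asm) ennreal_le_iff) (simp_all add: mult_ac)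
qed

end
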